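(* Up to equivalence, the $SO(2)$-invariant Jordan $\mathcal A_0$-multialgebras in $\mathrm{Sym}(\mathcal T)$ are exactly the following 23 subspaces $\Pi=\{K(X,Y):X\in V,\ Y\in W\}$, listed by $(W,V)$. Here $e_1,e_2$ is the standard basis, $z_0=(1,-i)$, $Z_0=z_0z_0^H=\begin{pmatrix}1&i\\-i&1\end{pmatrix}$, $\psi(x+iy)=\begin{pmatrix} x & y \\ {y} & -x \end{pmatrix}$ for $x,y\in\mathbb R$, $\Phi=\left\{\begin{pmatrix}\alpha&i\beta\\-i\beta&\alpha\end{pmatrix}:\alpha,\beta\in\mathbb R\right\}$, $\Psi=\{\psi(z):z\in\mathbb C\}$, $W_{\mathcal D}$ is the space of complex diagonal matrices, and $W_0=\mathrm{span}_{\mathbb C}\{I_2,z_0z_0^T\}$. $W=\{0\}$: (1) $V=\{0\}$; (2) $V=\mathbb RZ_0$. $W=\mathbb CI_2$: (3) $V=\{0\}$; (4) $V=\mathbb RI_2$; (5) $V=\mathbb R\psi(i)$; (6) $V=\mathbb R\, iR_\perp$; (7) $V=\mathbb RZ_0$; (8) $V=\Phi$; (9) $V=\Psi$. $W=\mathbb Ce_1e_1^T$: (10) $V=\{0\}$; (11) $V=\mathbb Re_1e_1^T$. $W=\mathbb Cz_0z_0^T$: (12) $V=\{0\}$; (13) $V=\mathbb RZ_0$. $W=W_{\mathcal D}$: (14) $V=\{0\}$; (15) $V=\mathbb Re_1e_1^T$; (16) $V=\mathrm{span}_{\mathbb R}\{e_1e_1^T,e_2e_2^T\}$; (17) $V=\left\{\begin{pmatrix}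 0 & \overline c \\ {c} & 0 \end{pmatrix}:c\in\mathbb C\right\}$. $W=W_0$: (18) $V=\{0\}$; (19) $V=\mathbb RZ_0$; (20) $V=\left\{\begin{pmatrix} y & x+iy \\ {x}-iy & y \end{pmatrix}:x,y\in\mathbb R\right\}$; (21) $V=\{X\in\mathfrak H(\mathbb C^2):\mathrm{Tr}X=2\,\mathrm{Im}(X_{12})\}$. $W=\mathrm{Sym}(\mathbb C^2)$: (22) $V=\{0\}$; (23) $V=\mathfrak H(\mathbb C^2)$.
   Context: Let $\mathcal T=\mathbb R^2\oplus\mathbb R^2$, identified with $\mathbb C^2$ via $(\mathbf u,\mathbf v)\mapsto(u_1+iu_2,v_1+iv_2)$. Each real-linear operator on $\mathcal T$ is uniquely of the form $K(X,Y)u=Xu+Y\overline u$ with complex $2\times2$ matrices $X,Y$. $\mathrm{Sym}(\mathcal T)$ denotes the real symmetric operators on $\mathcal T$; $K(X,Y)\in\mathrm{Sym}(\mathcal T)$ iff $X\in\mathfrak H(\mathbb C^2)$ (complex Hermitian $2\times2$ matrices, a real vector space) and $Y\in\mathrm{Sym}(\mathbb C^2)$ (complex symmetric $2\times2$ matrices, a complex vector space). $X^H=\overline X^T$; $R_\perp=\begin{pmatrix}0&-1\\1&0\end{pmatrix}$. Rotations act by $R_\theta\cdot K(X,Y)=K(X,e^{2i\theta}Y)$. Let $\mathcal A_0=\{K(0,zI_2):z\in\mathbb C\}$. A real subspace $\Pi\subset\mathrm{Sym}(\mathcal T)$ is a Jordan $\mathcal A_0$-multialgebra if $\frac12(\mathsf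 K_1\mathsf A\mathsf K_2+\mathsf K_2\mathsf A\mathsf K_1)\in\Pi$ for all $\mathsf K_1,\mathsf K_2\in\Pi$, $\mathsf A\in\mathcal A_0$. It is $SO(2)$-invariant if $R_\theta\cdot\Pi=\Pi$ for all $\theta$; equivalently $\Pi=\{K(X,Y):X\in V,Y\in W\}$ for a real subspace $V\subset\mathfrak H(\mathbb C^2)$ and a complex subspace $W\subset\mathrm{Sym}(\mathbb C^2)$. Two such multialgebras are equivalent if one is the image of the other under a map $K(X,Y)\mapsto K(\pm CXC^H,CYC^T)$ with $C\in O(2,\mathbb C)=\{C:CC^T=I_2\}$. *)

theory Defs
  imports "HOL-Analysis.Analysis"
begin

section \<open>Complex \<open>2 \<times> 2\<close> matrices\<close>

definition mat2 :: "complex \<Rightarrow> complex \<Rightarrow> complex \<Rightarrow> complex \<Rightarrow> complex^2^2" where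
  "mat2 a b c d = vector [vector [a, b], vector [c, d]]"

lemma mat2_nth [simp]:
  "mat2 a b c d $ 1 $ 1 = a" "mat2 a b c d $ 1 $ 2 = b"
  "mat2 a b c d $ 2 $ 1 = c" "mat2 a b c d $ 2 $ 2 = d"
  by (simp_all add: mat2_def)

definition cnjv :: "complex^2 \<Rightarrow> complex^2" where
  "cnjv u = (\<chi> i. cnj (u $ i))"

definition ctranspose :: "complex^2^2 \<Rightarrow> complex^2^2" where
  "ctranspose X = transpose (map_matrix cnj X)"

definition outer :: "complex^2 \<Rightarrow> complex^2 \<Rightarrow> complex^2^2" where
  "outer u v = (\<chi> i j. u $ i * v $ j)"

definition cscale :: "complex \<Rightarrow> complex^2^2 \<Rightarrow> complex^2^2" where
  "cscale c X = (\<chi> i j. c * X $ i $ j)"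

text \<open>The type of matrices is a \<^emph>\<open>real\<close> vector space in the library, with span
  \<^const>\<open>span\<close>; its complex structure, with span \<open>cmat.span\<close>, is added here.\<close>

global_interpretation cmat: vector_space cscale
  by unfold_locales (simp_all add: cscale_def vec_eq_iff algebra_simps)

definition hermitian_mats :: "(complex^2^2) set" where
  "hermitian_mats = {X. ctranspose X = X}"

definition symmetric_mats :: "(complex^2^2) set" where
  "symmetric_mats = {Y. transpose Y = Y}"


section \<open>Real-linear operators on \<open>\<T> = \<complex>\<^sup>2\<close>\<close>

text \<open>The space \<open>\<T> = \<real>\<^sup>2 \<oplus> \<real>\<^sup>2\<close> is taken in its identification with \<open>\<complex>\<^sup>2\<close>. The library's inner
  product on \<^typ>\<open>complex^2\<close> is the real one, which is the standard inner product of
  \<open>\<real>\<^sup>2 \<oplus> \<real>\<^sup>2\<close> under this identification, and \<open>T_op\<close> below is the type of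
  real-linear operators, boundedness being automatic in finite dimension.\<close>

type_synonym T_op = "(complex^2) \<Rightarrow>\<^sub>L (complex^2)"

lift_definition K :: "complex^2^2 \<Rightarrow> complex^2^2 \<Rightarrow> T_op"
  is "\<lambda>X Y u. X *v u + Y *v cnjv u"
  unfolding linear_conv_bounded_linear [symmetric]
  by (intro linearI)
     (simp_all add: vec_eq_iff cnjv_def matrix_vector_mult_def sum_2 algebra_simps)

definition sym_ops :: "T_op set" where
  "sym_ops = {A. \<forall>u v. blinfun_apply A u \<bullet> v = u \<bullet> blinfun_apply A v}"

lemma K_apply_nth:
  "blinfun_apply (K X Y) u $ i
     = X$i$1 * u$1 + X$i$2 * u$2 + (Y$i$1 * cnj (u$1) + Y$i$2 * cnj (u$2))"
  by (simp add: K.rep_eq cnjv_def matrix_vector_mult_def sum_2)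

lemma K_unique_representation: "\<exists>!(X, Y). A = K X Y"
proof -
  have real_basis: "u = (\<Sum>j\<in>UNIV. Re (u$j) *\<^sub>R axis j 1 + Im (u$j) *\<^sub>R axis j \<i>)"
    for u :: "complex^2"
    by (simp add: vec_eq_iff forall_2 sum_2 axis_def complex_eq_iff)
  define X :: "complex^2^2" where
    "X = (\<chi> i j. (blinfun_apply A (axis j 1) $ i - \<i> * blinfun_apply A (axis j \<i>) $ i) / 2)"
  define Y :: "complex^2^2" where
    "Y = (\<chi> i j. (blinfun_apply A (axis j 1) $ i + \<i> * blinfun_apply A (axis j \<i>) $ i) / 2)"
  have "blinfun_apply A u = blinfun_apply (K X Y) u" for u
  proof -
    have "blinfun_apply A u = blinfun_apply A (\<Sum>j\<in>UNIV. Re (u$j) *\<^sub>R axis j 1 + Im (u$j) *\<^sub>R axis j \<i>)"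
      using real_basis [of u] by (rule arg_cong)
    also have "\<dots> = (\<Sum>j\<in>UNIV. Re (u$j) *\<^sub>R blinfun_apply A (axis j 1)
            + Im (u$j) *\<^sub>R blinfun_apply A (axis j \<i>))"
      by (simp add: sum_2 blinfun.add_right blinfun.scaleR_right)
    finally have 1: "blinfun_apply A u = (\<Sum>j\<in>UNIV. Re (u$j) *\<^sub>R blinfun_apply A (axis j 1)
            + Im (u$j) *\<^sub>R blinfun_apply A (axis j \<i>))" .
    have "blinfun_apply A u $ i = blinfun_apply (K X Y) u $ i" for i
      unfolding 1 K_apply_nth
      by (simp add: sum_2 X_def Y_def complex_eq_iff field_simps)
    then show ?thesis by (simp add: vec_eq_iff)
  qed
  then have ex: "A = K X Y" by (rule blinfun_eqI)
  have "X' = X \<and> Y' = Y" if A: "A = K X' Y'" for X' Y'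
    unfolding X_def Y_def A
    by (simp add: vec_eq_iff forall_2 K_apply_nth axis_def algebra_simps)
  with ex show ?thesis by auto
qed

lemma K_in_sym_ops_iff: "K X Y \<in> sym_ops \<longleftrightarrow> X \<in> hermitian_mats \<and> Y \<in> symmetric_mats"
proof
  assume *: "K X Y \<in> sym_ops"
  have ax: "blinfun_apply (K X Y) (axis i a) $ j = X$j$i * a + Y$j$i * cnj a" for i j :: 2 and a
    using exhaust_2 [of i] by (auto simp: K_apply_nth axis_def)
  have eq: "(X$j$i * a + Y$j$i * cnj a) \<bullet> b = a \<bullet> (X$i$j * b + Y$i$j * cnj b)" for i j a b
  proof -
    have "blinfun_apply (K X Y) (axis i a) \<bullet> axis j b
        = axis i a \<bullet> blinfun_apply (K X Y) (axis j b)"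
      using * by (simp add: sym_ops_def)
    then show ?thesis by (simp add: inner_axis inner_axis' ax)
  qed
  have "cnj (X$j$i) = X$i$j \<and> Y$j$i = Y$i$j" for i j
    using eq [of j i 1 1] eq [of j i 1 \<i>] eq [of j i \<i> 1] eq [of j i \<i> \<i>]
    by (simp add: inner_complex_def complex_eq_iff)
  then show "X \<in> hermitian_mats \<and> Y \<in> symmetric_mats"
    by (simp add: hermitian_mats_def symmetric_mats_def ctranspose_def transpose_def vec_eq_iff)
next
  assume XY: "X \<in> hermitian_mats \<and> Y \<in> symmetric_mats"
  have X: "cnj (X$j$i) = X$i$j" for i j
  proof -
    have "ctranspose X $ i $ j = X$i$j" using XY by (simp add: hermitian_mats_def)
    then show ?thesis by (simp add: ctranspose_def transpose_def)
  qed
  have "transpose Y $ 2 $ 1 = Y$2$1" using XY by (simp add: symmetric_mats_def)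
  then have Y: "Y$2$1 = Y$1$2" by (simp add: transpose_def)
  have lin: "(a * u) \<bullet> v = u \<bullet> (cnj a * v)" and anti: "cnj u \<bullet> (cnj a * v) = u \<bullet> (a * cnj v)"
    for a u v :: complex
    by (simp_all add: inner_complex_def algebra_simps)
  show "K X Y \<in> sym_ops"
    by (simp add: sym_ops_def inner_vec_def sum_2 K_apply_nth inner_add_left inner_add_right
        lin anti X Y)
qed


section \<open>\<open>SO(2)\<close>-invariant Jordan \<open>\<A>\<^sub>0\<close>-multialgebras\<close>

definition A0 :: "T_op set" where
  "A0 = {K 0 (cscale z (mat 1)) | z. True}"

definition jordan_A0_multialgebra :: "T_op set \<Rightarrow> bool" where
  "jordan_A0_multialgebra P \<longleftrightarrow> P \<subseteq> sym_ops \<and> subspace P \<and>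
     (\<forall>K1\<in>P. \<forall>K2\<in>P. \<forall>A\<in>A0.
        (1/2) *\<^sub>R ((K1 o\<^sub>L A o\<^sub>L K2) + (K2 o\<^sub>L A o\<^sub>L K1)) \<in> P)"

definition rotate_ops ::
  "real \<Rightarrow> T_op set \<Rightarrow> T_op set" where
  "rotate_ops \<theta> P = {K X (cscale (exp (2 * \<i> * of_real \<theta>)) Y) | X Y. K X Y \<in> P}"

definition SO2_invariant :: "T_op set \<Rightarrow> bool" where
  "SO2_invariant P \<longleftrightarrow> (\<forall>\<theta>. rotate_ops \<theta> P = P)"

definition O2C :: "(complex^2^2) set" where
  "O2C = {C. C ** transpose C = mat 1}"

definition equivalent_ops ::
  "T_op set \<Rightarrow> T_op set \<Rightarrow> bool" where
  "equivalent_ops P P' \<longleftrightarrow> (\<exists>C\<in>O2C. \<exists>s\<in>{1, -1::real}.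
     P' = {K (s *\<^sub>R (C ** X ** ctranspose C)) (C ** Y ** transpose C) | X Y. K X Y \<in> P})"


section \<open>The list of normal forms\<close>

definition ops_of ::
  "(complex^2^2) set \<times> (complex^2^2) set \<Rightarrow> T_op set" where
  "ops_of WV = {K X Y | X Y. X \<in> snd WV \<and> Y \<in> fst WV}"

definition e1 :: "complex^2" where "e1 = axis 1 1"
definition e2 :: "complex^2" where "e2 = axis 2 1"

definition z0 :: "complex^2" where "z0 = vector [1, -\<i>]"

definition Z0 :: "complex^2^2" where "Z0 = outer z0 (cnjv z0)"

lemma Z0_eq: "Z0 = mat2 1 \<i> (-\<i>) 1"
  by (simp add: Z0_def outer_def cnjv_def z0_def vec_eq_iff forall_2)

definition Rperp :: "complex^2^2" where "Rperp = mat2 0 (-1) 1 0"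

definition psi :: "complex \<Rightarrow> complex^2^2" where
  "psi z = mat2 (of_real (Re z)) (of_real (Im z)) (of_real (Im z)) (- of_real (Re z))"

definition Phi_space :: "(complex^2^2) set" where
  "Phi_space = {mat2 (of_real \<alpha>) (\<i> * of_real \<beta>) (- \<i> * of_real \<beta>) (of_real \<alpha>) | \<alpha> \<beta>. True}"

definition Psi_space :: "(complex^2^2) set" where
  "Psi_space = range psi"

definition W_D :: "(complex^2^2) set" where
  "W_D = {mat2 a 0 0 d | a d. True}"

definition W_0 :: "(complex^2^2) set" where
  "W_0 = cmat.span {mat 1, outer z0 z0}"

text \<open>The pairs are \<open>(W, V)\<close>, with \<open>W\<close> first.\<close>

definition normal_forms :: "((complex^2^2) set \<times> (complex^2^2) set) list" where
  "normal_forms =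
   [({0}, {0}),
    ({0}, span {Z0}),
    (cmat.span {mat 1}, {0}),
    (cmat.span {mat 1}, span {mat 1}),
    (cmat.span {mat 1}, span {psi \<i>}),
    (cmat.span {mat 1}, span {cscale \<i> Rperp}),
    (cmat.span {mat 1}, span {Z0}),
    (cmat.span {mat 1}, Phi_space),
    (cmat.span {mat 1}, Psi_space),
    (cmat.span {outer e1 e1}, {0}),
    (cmat.span {outer e1 e1}, span {outer e1 e1}),
    (cmat.span {outer z0 z0}, {0}),
    (cmat.span {outer z0 z0}, span {Z0}),
    (W_D, {0}),
    (W_D, span {outer e1 e1}),
    (W_D, span {outer e1 e1, outer e2 e2}),
    (W_D, {mat2 0 (cnj c) c 0 | c. True}),
    (W_0, {0}),
    (W_0, span {Z0}),
    (W_0, {mat2 (of_real y) (Complex x y) (Complex x (-y)) (of_real y) | x y. True}),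
    (W_0, {X \<in> hermitian_mats. trace X = of_real (2 * Im (X $ 1 $ 2))}),
    (symmetric_mats, {0}),
    (symmetric_mats, hermitian_mats)]"

end

theory Submission
  imports Defs
begin

text \<open>Rotation invariance splits \<open>\<Pi>\<close> into a real space \<open>V\<close> and a complex space \<open>W\<close>, and the
  multialgebra condition becomes three conditions: \<open>Y\<^sup>2 \<in> W\<close>, \<open>XX\<^sup>T \<in> W\<close> and
  \<open>YX + (YX)\<^sup>H \<in> V\<close> for \<open>X \<in> V\<close>, \<open>Y \<in> W\<close>. The vector \<open>z\<^sub>0\<close> and its conjugate are isotropic and
  are common eigenvectors of \<open>SO(2, \<complex>)\<close>; in the matrix coordinates that they define, all three
  conditions are short and the group acts diagonally. By the first condition \<open>W\<close> is a Jordan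
  subalgebra of the three-dimensional spin factor \<open>Sym(\<complex>\<^sup>2)\<close>: either \<open>I \<in> W\<close>, and then \<open>W\<close> is
  determined by a subspace of the plane of trace-free matrices, or the determinant
  vanishes on \<open>W\<close>, and then \<open>dim W \<le> 1\<close>. For each \<open>W\<close> the other two conditions leave few \<open>V\<close>.
  Inequivalent normal forms differ in the signs and vanishing of traces and determinants on
  \<open>W\<close> and \<open>V\<close>.\<close>

section \<open>Coordinates\<close>

text \<open>The three conditions arise because A = K(0, zI) conjugates whatever stands to its right:
  the two components of K1 A K2 are cnj z Y1 X2 + z X1 cnj Y2 and z X1 cnj X2 + cnj z Y1 Y2, and cnj
  X = X^T for Hermitian X. The isotropic vectors help because z0^T z0 = 0 and z0^H z0 = 2, so that a
  product of two matrices among Z0, N and their conjugates is zero or twice one of the four. The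
  classification of V is carried out only after W has been moved to a standard position. Parameters
  then remain only in real lines, for W = C I and for W = W_0; what removes them is the part of
  SO(2, C) that fixes W. For inequivalence the obstacle is that C is not unitary, so the trace of X
  is not preserved. What survives is det X, because det C is 1 or -1, and the trace of X X^T,
  because X X^T is transformed in the same way as the elements of W.\<close>

text \<open>Writing \<open>N = z\<^sub>0z\<^sub>0\<^sup>T\<close> and \<open>M'\<close> for the complex conjugate of \<open>M\<close>, these are
  \<open>aZ\<^sub>0 + bZ\<^sub>0' + gN + g'N'\<close> and \<open>2yI + uN + wN'\<close>.\<close>

fun xmat :: "real \<times> real \<times> complex \<Rightarrow> complex^2^2" where
  "xmat (a, b, g) =
     mat2 (of_real a + of_real b + g + cnj g) (\<i> * (of_real a - of_real b - g + cnj g))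
          (- \<i> * (of_real a - of_real b + g - cnj g)) (of_real a + of_real b - g - cnj g)"

fun ymat :: "complex \<times> complex \<times> complex \<Rightarrow> complex^2^2" where
  "ymat (y, u, w) = mat2 (2 * y + u + w) (\<i> * (w - u)) (\<i> * (w - u)) (2 * y - u - w)"

text \<open>Half of X cnj X' + X' cnj X. For x = x' it is X X^T, so it is the polarised form of the
  condition on X X^T.\<close>

fun xprod :: "real \<times> real \<times> complex \<Rightarrow> real \<times> real \<times> complex \<Rightarrow> complex \<times> complex \<times> complex" where
  "xprod (a, b, g) (a', b', g') =
     (of_real (a * b' + a' * b) + g * cnj g' + g' * cnj g, 2 * (of_real a * g' + of_real a' * g),
      2 * (of_real b * cnj g' + of_real b' * cnj g))"

fun yprod :: "complex \<times> complex \<times> complex \<Rightarrow> complex \<times> complex \<times> complex \<Rightarrow> complex \<times> complex \<times> complex" where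
  "yprod (y, u, w) (y', u', w') = (2 * y * y' + u * w' + u' * w, 2 * (y * u' + y' * u), 2 * (y * w' + y' * w))"

text \<open>Half of Y X + X cnj Y, that is, half of Y X + (Y X)^H. The map is only real-linear in Y,
  in keeping with V being a real space.\<close>

fun yact :: "complex \<times> complex \<times> complex \<Rightarrow> real \<times> real \<times> complex \<Rightarrow> real \<times> real \<times> complex" where
  "yact (y, u, w) (a, b, g) =
     (2 * Re y * a + 2 * Re (u * cnj g), 2 * Re y * b + 2 * Re (w * g),
      2 * of_real (Re y) * g + u * of_real b + cnj w * of_real a)"

fun cmul :: "complex \<Rightarrow> complex \<times> complex \<times> complex \<Rightarrow> complex \<times> complex \<times> complex" where
  "cmul c (y, u, w) = (c * y, c * u, c * w)"

abbreviation cnjm :: "complex^2^2 \<Rightarrow> complex^2^2" where "cnjm \<equiv> map_matrix cnj"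

lemma mat2_eq_iff: "X = Y \<longleftrightarrow> X$1$1 = Y$1$1 \<and> X$1$2 = Y$1$2 \<and> X$2$1 = Y$2$1 \<and> X$2$2 = Y$2$2"
  for X Y :: "complex^2^2"
  by (auto simp: vec_eq_iff forall_2)

lemma mat_mult_nth: "(X ** Y) $ i $ j = X$i$1 * Y$1$j + X$i$2 * Y$2$j" for X Y :: "complex^2^2"
  by (simp add: matrix_matrix_mult_def sum_2)

lemma transpose_nth: "transpose X $ i $ j = X $ j $ i"
  by (simp add: transpose_def)

lemma ctranspose_nth: "ctranspose X $ i $ j = cnj (X $ j $ i)"
  by (simp add: ctranspose_def transpose_def)

lemma cnjm_nth: "cnjm X $ i $ j = cnj (X $ i $ j)"
  by simp

lemma cscale_nth: "cscale c X $ i $ j = c * X $ i $ j"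
  by (simp add: cscale_def)

lemmas mat_entries = mat2_eq_iff mat_mult_nth transpose_nth ctranspose_nth cnjm_nth cscale_nth

lemma xmat_yact: "ymat y ** xmat x + xmat x ** cnjm (ymat y) = 2 *\<^sub>R xmat (yact y x)"
  by (cases y; cases x) (simp add: mat_entries complex_eq_iff algebra_simps)

lemma ymat_yprod: "ymat y ** ymat y' + ymat y' ** ymat y = 2 *\<^sub>R ymat (yprod y y')"
  by (cases y; cases y') (simp add: mat_entries complex_eq_iff algebra_simps)

lemma ymat_xprod: "xmat x ** cnjm (xmat x') + xmat x' ** cnjm (xmat x) = 2 *\<^sub>R ymat (xprod x x')"
  by (cases x; cases x') (simp add: mat_entries complex_eq_iff algebra_simps)

lemma xmat_add: "xmat (x + x') = xmat x + xmat x'"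
  by (cases x; cases x') (auto simp: mat2_eq_iff field_simps)

lemma xmat_scaleR: "xmat (r *\<^sub>R x) = r *\<^sub>R xmat x"
  by (cases x) (auto simp: mat2_eq_iff complex_eq_iff field_simps)

lemma ymat_add: "ymat (y + y') = ymat y + ymat y'"
  by (cases y; cases y') (auto simp: mat2_eq_iff field_simps)

lemma ymat_cmul: "ymat (cmul c y) = cscale c (ymat y)"
  by (cases y) (auto simp: mat2_eq_iff cscale_nth field_simps)

lemma cmul_scaleR: "cmul (of_real r) y = r *\<^sub>R y"
  by (cases y) (auto simp: scaleR_conv_of_real)

lemma xmat_0: "xmat 0 = 0" and ymat_0: "ymat 0 = 0"
  by (auto simp: mat2_eq_iff zero_prod_def)

lemma range_xmat: "range xmat = hermitian_mats"
proof
  show "range xmat \<subseteq> hermitian_mats"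
  proof (intro image_subsetI)
    fix x show "xmat x \<in> hermitian_mats"
      by (cases x) (simp add: hermitian_mats_def mat_entries complex_eq_iff)
  qed
  show "hermitian_mats \<subseteq> range xmat"
  proof
    fix X assume "X \<in> hermitian_mats"
    then have "Im (X$1$1) = 0" "Im (X$2$2) = 0" "Re (X$2$1) = Re (X$1$2)" "Im (X$2$1) = - Im (X$1$2)"
      unfolding hermitian_mats_def mem_Collect_eq mat2_eq_iff ctranspose_nth complex_eq_iff cnj.sel
      by linarith+
    then have "X = xmat ((Re (X$1$1) + Re (X$2$2)) / 4 + Im (X$1$2) / 2, (Re (X$1$1) + Re (X$2$2)) / 4 - Im (X$1$2) / 2,
        Complex ((Re (X$1$1) - Re (X$2$2)) / 4) (Re (X$1$2) / 2))"
      by (simp add: mat2_eq_iff complex_eq_iff field_simps)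
    then show "X \<in> range xmat" by blast
  qed
qed

lemma range_ymat: "range ymat = symmetric_mats"
proof
  show "range ymat \<subseteq> symmetric_mats"
  proof (intro image_subsetI)
    fix y show "ymat y \<in> symmetric_mats"
      by (cases y) (simp add: symmetric_mats_def mat_entries)
  qed
  show "symmetric_mats \<subseteq> range ymat"
  proof
    fix Y assume "Y \<in> symmetric_mats"
    then have "Y$2$1 = Y$1$2"
      unfolding symmetric_mats_def mem_Collect_eq mat2_eq_iff transpose_nth by blast
    then have "Y = ymat ((Y$1$1 + Y$2$2) / 4, (Y$1$1 - Y$2$2) / 4 + \<i> * Y$1$2 / 2, (Y$1$1 - Y$2$2) / 4 - \<i> * Y$1$2 / 2)"
      by (simp add: mat2_eq_iff complex_eq_iff field_simps)
    then show "Y \<in> range ymat" by blast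
  qed
qed

section \<open>Algebra of the operators K(X, Y)\<close>

lemma K_inject: "K X Y = K X' Y' \<longleftrightarrow> X = X' \<and> Y = Y'"
proof
  assume eq: "K X Y = K X' Y'"
  have ex: "\<exists>!(U, V). K X Y = K U V"
    by (rule K_unique_representation)
  have "(X, Y) = (X', Y')"
    using the1_equality[OF ex, of "(X, Y)"] the1_equality[OF ex, of "(X', Y')"] eq by simp
  then show "X = X' \<and> Y = Y'" by simp
qed simp

lemma K_surj: obtains X Y where "A = K X Y"
proof -
  obtain p where "case p of (X, Y) \<Rightarrow> A = K X Y"
    using K_unique_representation[of A] by (elim ex1E)
  then show ?thesis by (cases p) (auto intro: that)
qed

lemma K_add: "K X Y + K X' Y' = K (X + X') (Y + Y')"
  by (rule blinfun_eqI) (simp add: vec_eq_iff K_apply_nth blinfun.add_left algebra_simps)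

lemma K_scaleR: "r *\<^sub>R K X Y = K (r *\<^sub>R X) (r *\<^sub>R Y)"
  by (rule blinfun_eqI) (simp add: vec_eq_iff K_apply_nth blinfun.scaleR_left algebra_simps)

lemma K_0: "K 0 0 = 0"
  by (rule blinfun_eqI) (simp add: vec_eq_iff K_apply_nth)

text \<open>The antilinear part Y conjugates the coefficients to its right, and two conjugations in
  succession give a linear term.\<close>

lemma K_compose: "K X Y o\<^sub>L K X' Y' = K (X ** X' + Y ** cnjm Y') (X ** Y' + Y ** cnjm X')"
  by (rule blinfun_eqI)
     (simp add: vec_eq_iff forall_2 K_apply_nth mat_mult_nth cnjm_nth algebra_simps)

text \<open>Attaching the scalar to Y as cnj z puts the Hermitian component into the shape M X + X
  cnj M, to which \<open>xmat_yact\<close> applies: the z in front of cnj Y is exactly the conjugate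
  of cnj z.\<close>

lemma K_jordan_product:
  "(1/2) *\<^sub>R ((K X1 Y1 o\<^sub>L K 0 (cscale z (mat 1)) o\<^sub>L K X2 Y2) + (K X2 Y2 o\<^sub>L K 0 (cscale z (mat 1)) o\<^sub>L K X1 Y1))
   = K ((1/2) *\<^sub>R ((cscale (cnj z) Y1 ** X2 + X2 ** cnjm (cscale (cnj z) Y1))
               + (cscale (cnj z) Y2 ** X1 + X1 ** cnjm (cscale (cnj z) Y2))))
       ((1/2) *\<^sub>R (cscale z (X1 ** cnjm X2 + X2 ** cnjm X1) + cscale (cnj z) (Y1 ** Y2 + Y2 ** Y1)))"
  unfolding K_compose K_add K_scaleR K_inject
  by (simp add: mat_entries mat_def algebra_simps)

declare xmat.simps [simp del] ymat.simps [simp del]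

lemma xmat_hermitian: "xmat x \<in> hermitian_mats" and ymat_symmetric: "ymat y \<in> symmetric_mats"
  using range_xmat range_ymat by blast+

lemma ymat_scaleR: "ymat (r *\<^sub>R y) = r *\<^sub>R ymat y"
  by (simp add: cmul_scaleR[symmetric] ymat_cmul mat2_eq_iff cscale_nth complex_eq_iff)

section \<open>Rotation-invariant multialgebras in coordinates\<close>

text \<open>The scalar z of an element of \<open>A0\<close> does not occur: in the Jordan product it
  multiplies only elements of W or products that lie in W, and W is closed under
  \<open>cmul\<close>. The products are polarised, which for subspaces is equivalent to the
  conditions on squares.\<close>

definition multialg :: "(complex \<times> complex \<times> complex) set \<Rightarrow> (real \<times> real \<times> complex) set \<Rightarrow> bool" where
  "multialg W V \<longleftrightarrow> subspace V \<and> 0 \<in> W \<and> (\<forall>y\<in>W. \<forall>y'\<in>W. y + y' \<in> W) \<and> (\<forall>c. \<forall>y\<in>W. cmul c y \<in> W)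
     \<and> (\<forall>x\<in>V. \<forall>x'\<in>V. xprod x x' \<in> W) \<and> (\<forall>y\<in>W. \<forall>y'\<in>W. yprod y y' \<in> W)
     \<and> (\<forall>y\<in>W. \<forall>x\<in>V. yact y x \<in> V)"

abbreviation coord_ops :: "(complex \<times> complex \<times> complex) set \<Rightarrow> (real \<times> real \<times> complex) set \<Rightarrow> T_op set" where
  "coord_ops W V \<equiv> ops_of (ymat ` W, xmat ` V)"

lemma in_coord_ops: "A \<in> coord_ops W V \<longleftrightarrow> (\<exists>x\<in>V. \<exists>y\<in>W. A = K (xmat x) (ymat y))"
  by (auto simp: ops_of_def)

lemma coord_ops_jordan:
  assumes "multialg W V"
  shows "jordan_A0_multialgebra (coord_ops W V)"
proof -
  have V: "subspace V" and W: "0 \<in> W" "\<And>y y'. y \<in> W \<Longrightarrow> y' \<in> W \<Longrightarrow> y + y' \<in> W"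
      "\<And>c y. y \<in> W \<Longrightarrow> cmul c y \<in> W"
    and a: "\<And>x x'. x \<in> V \<Longrightarrow> x' \<in> V \<Longrightarrow> xprod x x' \<in> W"
    and b: "\<And>y y'. y \<in> W \<Longrightarrow> y' \<in> W \<Longrightarrow> yprod y y' \<in> W"
    and c: "\<And>x y. y \<in> W \<Longrightarrow> x \<in> V \<Longrightarrow> yact y x \<in> V"
    using assms by (auto simp: multialg_def)
  have Wr: "r *\<^sub>R y \<in> W" if "y \<in> W" for r y
    using W(3)[OF that, of "of_real r"] by (simp add: cmul_scaleR)
  have 1: "coord_ops W V \<subseteq> sym_ops"
    by (auto simp: in_coord_ops K_in_sym_ops_iff xmat_hermitian ymat_symmetric)
  have 2: "subspace (coord_ops W V)"
    unfolding subspace_def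
  proof (intro conjI ballI allI)
    show "0 \<in> coord_ops W V"
      using V W(1) by (auto simp: in_coord_ops subspace_0 xmat_0 ymat_0 K_0 intro!: bexI[of _ 0])
    show "A + B \<in> coord_ops W V" if "A \<in> coord_ops W V" "B \<in> coord_ops W V" for A B
    proof -
      from that obtain x y x' y' where "x \<in> V" "y \<in> W" "x' \<in> V" "y' \<in> W"
        "A = K (xmat x) (ymat y)" "B = K (xmat x') (ymat y')"
        by (auto simp: in_coord_ops)
      then have "x + x' \<in> V" "y + y' \<in> W" "A + B = K (xmat (x + x')) (ymat (y + y'))"
        by (simp_all add: K_add xmat_add ymat_add subspace_add[OF V] W(2))
      then show ?thesis unfolding in_coord_ops by blast
    qed
    show "r *\<^sub>R A \<in> coord_ops W V" if "A \<in> coord_ops W V" for A r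
    proof -
      from that obtain x y where "x \<in> V" "y \<in> W" "A = K (xmat x) (ymat y)"
        by (auto simp: in_coord_ops)
      then have "r *\<^sub>R x \<in> V" "r *\<^sub>R y \<in> W" "r *\<^sub>R A = K (xmat (r *\<^sub>R x)) (ymat (r *\<^sub>R y))"
        by (simp_all add: K_scaleR xmat_scaleR ymat_scaleR subspace_scale[OF V] Wr)
      then show ?thesis unfolding in_coord_ops by blast
    qed
  qed
  have cs2: "cscale c (2 *\<^sub>R Y) = 2 *\<^sub>R cscale c Y" for c Y
    by (simp add: mat2_eq_iff cscale_nth)
  show ?thesis
    unfolding jordan_A0_multialgebra_def
  proof (intro conjI ballI 1 2)
    fix K1 K2 A assume "K1 \<in> coord_ops W V" "K2 \<in> coord_ops W V" "A \<in> A0"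
    then obtain x y x' y' z where *: "x \<in> V" "y \<in> W" "x' \<in> V" "y' \<in> W"
        "K1 = K (xmat x) (ymat y)" "K2 = K (xmat x') (ymat y')" "A = K 0 (cscale z (mat 1))"
      by (auto simp: in_coord_ops A0_def)
    have "(yact (cmul (cnj z) y) x' + yact (cmul (cnj z) y') x) \<in> V"
      using V W c * by (intro subspace_add) auto
    moreover have "(cmul z (xprod x x') + cmul (cnj z) (yprod y y')) \<in> W"
      using * W a b by (intro W(2)) auto
    ultimately show "(1/2) *\<^sub>R ((K1 o\<^sub>L A o\<^sub>L K2) + (K2 o\<^sub>L A o\<^sub>L K1)) \<in> coord_ops W V"
      unfolding * K_jordan_product ymat_cmul[symmetric] xmat_yact ymat_yprod ymat_xprod
        cs2 scaleR_add_right[symmetric] scaleR_scaleR ymat_cmul[symmetric] xmat_add[symmetric] ymat_add[symmetric] in_coord_ops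
      by auto
  qed
qed

lemma coord_ops_SO2:
  assumes "multialg W V"
  shows "SO2_invariant (coord_ops W V)"
  unfolding SO2_invariant_def
proof
  fix \<theta> :: real
  define e where "e = exp (2 * \<i> * of_real \<theta>)"
  have W: "cmul c y \<in> W" if "y \<in> W" for c y
    using assms that by (auto simp: multialg_def)
  have e: "e * inverse e = 1" by (simp add: e_def)
  have inv: "cmul e (cmul (inverse e) y) = y" for y
    by (cases y) (simp add: e mult.assoc[symmetric])
  show "rotate_ops \<theta> (coord_ops W V) = coord_ops W V"
  proof
    show "rotate_ops \<theta> (coord_ops W V) \<subseteq> coord_ops W V"
      unfolding rotate_ops_def e_def[symmetric]
    proof clarify
      fix X Y assume "K X Y \<in> coord_ops W V"
      then obtain x y where "x \<in> V" "y \<in> W" "X = xmat x" "Y = ymat y"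
        unfolding in_coord_ops K_inject by blast
      then show "K X (cscale e Y) \<in> coord_ops W V"
        unfolding in_coord_ops K_inject using W ymat_cmul by metis
    qed
    show "coord_ops W V \<subseteq> rotate_ops \<theta> (coord_ops W V)"
    proof
      fix A assume "A \<in> coord_ops W V"
      then obtain x y where xy: "x \<in> V" "y \<in> W" "A = K (xmat x) (ymat y)"
        unfolding in_coord_ops by blast
      have "K (xmat x) (ymat (cmul (inverse e) y)) \<in> coord_ops W V"
        unfolding in_coord_ops K_inject using xy(1) W[OF xy(2)] by blast
      moreover have "A = K (xmat x) (cscale e (ymat (cmul (inverse e) y)))"
        by (simp add: xy(3) ymat_cmul[symmetric] inv)
      ultimately show "A \<in> rotate_ops \<theta> (coord_ops W V)"
        unfolding rotate_ops_def e_def[symmetric] by blast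
    qed
  qed
qed

text \<open>The angle pi/2 replaces Y by -Y, so an average removes Y. Subtracting K X 0 from a
  rotated operator leaves a multiple of Y by a phase; half the argument of c gives the right phase,
  since a rotation acts through twice its angle, and the real factor |c| does the rest.\<close>

lemma SO2_invariant_parts:
  assumes "subspace P" "SO2_invariant P" "K X Y \<in> P"
  shows "K X 0 \<in> P" "K 0 (cscale c Y) \<in> P"
proof -
  have rot: "K X (cscale (exp (2 * \<i> * of_real \<theta>)) Y) \<in> P" for \<theta>
    using assms(2,3) unfolding SO2_invariant_def rotate_ops_def by blast
  have "exp (2 * \<i> * of_real (pi / 2)) = -1" "cscale (-1) Y = - Y"
    by (simp_all add: exp_pi_i' mat2_eq_iff cscale_nth)
  then have m: "K X (- Y) \<in> P"
    using rot[of "pi/2"] by (simp only:)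
  have "(1/2) *\<^sub>R (K X Y + K X (-Y)) \<in> P"
    using assms m by (intro subspace_scale subspace_add)
  then show X: "K X 0 \<in> P" by (simp add: K_add K_scaleR scaleR_2[symmetric] del: scaleR_left.add)
  have "norm c *\<^sub>R (K X (cscale (exp (2 * \<i> * of_real (Arg c / 2))) Y) + (-1) *\<^sub>R K X 0) \<in> P"
    by (intro subspace_scale subspace_add assms rot X)
  moreover have "of_real (norm c) * exp (\<i> * of_real (Arg c)) = c"
    by (metis Arg_eq mult_zero_left norm_zero of_real_0)
  then have "norm c *\<^sub>R cscale (exp (\<i> * of_real (Arg c))) Y = cscale c Y"
    by (simp add: mat2_eq_iff cscale_nth scaleR_conv_of_real[where 'a=complex] mult.assoc[symmetric])
  ultimately show "K 0 (cscale c Y) \<in> P"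
    by (simp add: K_add K_scaleR)
qed

text \<open>V and W are the slices of P along the two axes, and P is their sum by
  \<open>SO2_invariant_parts\<close>. Jordan products with z = 1 of elements of the slices isolate
  the three products one by one.\<close>

lemma SO2_invariant_eq_coord_ops:
  assumes J: "jordan_A0_multialgebra P" and S: "SO2_invariant P"
  obtains W V where "multialg W V" "P = coord_ops W V"
proof
  define V where "V = {x. K (xmat x) 0 \<in> P}"
  define W where "W = {y. K 0 (ymat y) \<in> P}"
  have P: "P \<subseteq> sym_ops" "subspace P" using J by (auto simp: jordan_A0_multialgebra_def)
  have jor: "(1/2) *\<^sub>R ((K1 o\<^sub>L K 0 (cscale z (mat 1)) o\<^sub>L K2) + (K2 o\<^sub>L K 0 (cscale z (mat 1)) o\<^sub>L K1)) \<in> P"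
    if "K1 \<in> P" "K2 \<in> P" for K1 K2 z
    using J that unfolding jordan_A0_multialgebra_def A0_def by blast
  have dbl: "A \<in> P" if "(1/2) *\<^sub>R A \<in> P" for A
    using subspace_scale[OF P(2) that, of 2] by simp
  have c0: "cscale c 0 = 0" and c1: "cscale 1 Y = Y" for c Y
    by (simp_all add: mat2_eq_iff cscale_nth)
  have m0: "X ** 0 = 0" "0 ** X = 0" "cnjm 0 = 0" for X :: "complex^2^2"
    by (simp_all add: mat_entries)
  show "multialg W V"
    unfolding multialg_def subspace_def
  proof (intro conjI ballI allI)
    show "0 \<in> V" "0 \<in> W" using P(2) by (auto simp: V_def W_def xmat_0 ymat_0 K_0 subspace_0)
    show "x + x' \<in> V" if "x \<in> V" "x' \<in> V" for x x'
      using subspace_add[OF P(2), of "K (xmat x) 0" "K (xmat x') 0"] that by (simp add: V_def K_add xmat_add)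
    show "r *\<^sub>R x \<in> V" if "x \<in> V" for x r
      using subspace_scale[OF P(2), of "K (xmat x) 0" r] that by (simp add: V_def K_scaleR xmat_scaleR)
    show "y + y' \<in> W" if "y \<in> W" "y' \<in> W" for y y'
      using subspace_add[OF P(2), of "K 0 (ymat y)" "K 0 (ymat y')"] that by (simp add: W_def K_add ymat_add)
    show "cmul c y \<in> W" if "y \<in> W" for c y
      using SO2_invariant_parts(2)[OF P(2) S, of 0 "ymat y" c] that by (simp add: W_def ymat_cmul)
    show "xprod x x' \<in> W" if "x \<in> V" "x' \<in> V" for x x'
      using jor[of "K (xmat x) 0" "K (xmat x') 0" 1] that
      unfolding K_jordan_product by (auto simp: V_def W_def c0 c1 m0 ymat_xprod K_scaleR)
    show "yprod y y' \<in> W" if "y \<in> W" "y' \<in> W" for y y'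
      using jor[of "K 0 (ymat y)" "K 0 (ymat y')" 1] that
      unfolding K_jordan_product by (auto simp: V_def W_def c0 c1 m0 ymat_yprod K_scaleR)
    show "yact y x \<in> V" if "y \<in> W" "x \<in> V" for y x
      using jor[of "K 0 (ymat y)" "K (xmat x) 0" 1] that
      unfolding K_jordan_product by (auto simp: V_def W_def c0 c1 m0 xmat_yact K_scaleR)
  qed
  show "P = coord_ops W V"
  proof
    show "coord_ops W V \<subseteq> P"
      using subspace_add[OF P(2)] by (fastforce simp: in_coord_ops V_def W_def K_add)
    show "P \<subseteq> coord_ops W V"
    proof
      fix A assume A: "A \<in> P"
      obtain X Y where XY: "A = K X Y" by (rule K_surj)
      then have "X \<in> hermitian_mats" "Y \<in> symmetric_mats" using P(1) A K_in_sym_ops_iff by auto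
      then obtain x y where "X = xmat x" "Y = ymat y"
        unfolding range_xmat[symmetric] range_ymat[symmetric] by blast
      moreover from this have "x \<in> V" "y \<in> W"
        using SO2_invariant_parts[OF P(2) S, of X Y] SO2_invariant_parts(2)[OF P(2) S, of X Y 1] A XY
        by (simp_all add: V_def W_def c1)
      ultimately show "A \<in> coord_ops W V"
        unfolding in_coord_ops XY by blast
    qed
  qed
qed

section \<open>Equivalence\<close>

definition hact :: "complex^2^2 \<Rightarrow> real \<Rightarrow> complex^2^2 \<Rightarrow> complex^2^2" where
  "hact C s X = s *\<^sub>R (C ** X ** ctranspose C)"

definition sact :: "complex^2^2 \<Rightarrow> complex^2^2 \<Rightarrow> complex^2^2" where
  "sact C Y = C ** Y ** transpose C"

definition opact :: "complex^2^2 \<Rightarrow> real \<Rightarrow> T_op set \<Rightarrow> T_op set" where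
  "opact C s P = {K (hact C s X) (sact C Y) | X Y. K X Y \<in> P}"

lemma equivalent_ops_iff: "equivalent_ops P P' \<longleftrightarrow> (\<exists>C\<in>O2C. \<exists>s\<in>{1, -1}. P' = opact C s P)"
  by (simp add: equivalent_ops_def opact_def hact_def sact_def)

lemma hact_compose: "hact D t (hact C s X) = hact (D ** C) (t * s) X"
proof -
  have "ctranspose (D ** C) = ctranspose C ** ctranspose D"
    by (simp add: mat_entries algebra_simps)
  then show ?thesis
    by (simp add: hact_def matrix_mul_assoc matrix_scaleR matrix_scalar_ac scalar_matrix_assoc
      flip: scaleR_scaleR)
qed

lemma sact_compose: "sact D (sact C Y) = sact (D ** C) Y"
  by (simp add: sact_def matrix_transpose_mul matrix_mul_assoc)

lemma opact_compose: "opact D t (opact C s P) = opact (D ** C) (t * s) P"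
proof -
  have "opact D t (opact C s P) = {K (hact D t X') (sact D Y') | X' Y'. \<exists>X Y. X' = hact C s X \<and> Y' = sact C Y \<and> K X Y \<in> P}"
    unfolding opact_def by (simp add: K_inject)
  also have "\<dots> = opact (D ** C) (t * s) P"
    unfolding opact_def hact_compose[symmetric] sact_compose[symmetric] by blast
  finally show ?thesis .
qed

lemma opact_one: "opact (mat 1) 1 P = P"
proof -
  have "ctranspose (mat 1) = mat 1"
    by (simp add: mat_entries mat_def)
  then have "opact (mat 1) 1 P = {K X Y | X Y. K X Y \<in> P}"
    by (simp add: opact_def hact_def sact_def transpose_mat)
  also have "\<dots> = P"
    using K_surj by (smt (verit) Collect_cong Collect_mem_eq)
  finally show ?thesis .
qed

lemma O2C_transpose: "C \<in> O2C \<Longrightarrow> transpose C \<in> O2C \<and> transpose C ** C = mat 1"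
  unfolding O2C_def by (simp add: matrix_left_right_inverse)

lemma O2C_mult: "C \<in> O2C \<Longrightarrow> D \<in> O2C \<Longrightarrow> D ** C \<in> O2C"
  unfolding O2C_def by (simp add: matrix_transpose_mul) (metis matrix_mul_assoc matrix_mul_rid)

lemma equivalent_ops_sym:
  assumes "equivalent_ops P P'"
  shows "equivalent_ops P' P"
proof -
  obtain C s where C: "C \<in> O2C" "s \<in> {1, -1}" "P' = opact C s P"
    using assms unfolding equivalent_ops_iff by blast
  have "opact (transpose C) s P' = P"
    using O2C_transpose[OF C(1)] C(2) by (auto simp: C(3) opact_compose opact_one)
  then show ?thesis
    unfolding equivalent_ops_iff using O2C_transpose[OF C(1)] C(2) by blast
qed

lemma equivalent_ops_trans:
  assumes "equivalent_ops P P'" "equivalent_ops P' P''"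
  shows "equivalent_ops P P''"
proof -
  obtain C s where C: "C \<in> O2C" "s \<in> {1, -1}" "P' = opact C s P"
    using assms(1) unfolding equivalent_ops_iff by blast
  obtain D t where D: "D \<in> O2C" "t \<in> {1, -1}" "P'' = opact D t P'"
    using assms(2) unfolding equivalent_ops_iff by blast
  have "P'' = opact (D ** C) (t * s) P" "t * s \<in> {1, -1}"
    using C D by (auto simp: opact_compose)
  then show ?thesis
    unfolding equivalent_ops_iff using O2C_mult C D by blast
qed

lemma equivalent_ops_refl: "equivalent_ops P P"
proof -
  have "mat 1 \<in> O2C" by (simp add: O2C_def transpose_mat)
  then show ?thesis unfolding equivalent_ops_iff using opact_one by blast
qed

lemma opact_coord_ops:
  assumes "\<And>x. hact C s (xmat x) = xmat (f x)" "\<And>y. sact C (ymat y) = ymat (g y)"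
  shows "opact C s (coord_ops W V) = coord_ops (g ` W) (f ` V)"
  unfolding opact_def set_eq_iff in_coord_ops mem_Collect_eq K_inject bex_simps
  using assms by metis

section \<open>Diagonal rotations and the reflection in isotropic coordinates\<close>

fun rotx :: "complex \<Rightarrow> real \<times> real \<times> complex \<Rightarrow> real \<times> real \<times> complex" where
  "rotx l (a, b, g) = ((cmod l)^2 * a, b / (cmod l)^2, l / cnj l * g)"

fun roty :: "complex \<Rightarrow> complex \<times> complex \<times> complex \<Rightarrow> complex \<times> complex \<times> complex" where
  "roty l (y, u, w) = (y, l^2 * u, w / l^2)"

fun swapx :: "real \<times> real \<times> complex \<Rightarrow> real \<times> real \<times> complex" where
  "swapx (a, b, g) = (b, a, cnj g)"

fun swapy :: "complex \<times> complex \<times> complex \<Rightarrow> complex \<times> complex \<times> complex" where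
  "swapy (y, u, w) = (y, w, u)"

text \<open>The matrix with eigenvalue \<open>2p\<close> at \<open>z\<^sub>0\<close> and \<open>2q\<close> at the conjugate of \<open>z\<^sub>0\<close>; it lies in
  \<^const>\<open>O2C\<close> if \<open>4pq = 1\<close>.\<close>

lemma hact_general:
  "hact (mat2 (p + q) (\<i> * (p - q)) (- \<i> * (p - q)) (p + q)) 1 (xmat (a, b, g))
   = xmat (4 * (cmod p)^2 * a, 4 * (cmod q)^2 * b, 4 * (p * cnj q * g))"
  unfolding hact_def xmat.simps cmod_power2
  by (simp add: mat_entries complex_eq_iff power2_eq_square algebra_simps)

lemma sact_general:
  "sact (mat2 (p + q) (\<i> * (p - q)) (- \<i> * (p - q)) (p + q)) (ymat (y, u, w))
   = ymat (4 * p * q * y, 4 * p^2 * u, 4 * q^2 * w)"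
  unfolding sact_def ymat.simps
  by (simp add: mat_entries complex_eq_iff power2_eq_square algebra_simps)

text \<open>The matrix C below is the general one with p = l/2 and q = 1/(2l), so 4pq = 1. It
  multiplies z0 by l and the conjugate of z0 by 1/l.\<close>

lemma equivalent_rot:
  assumes "l \<noteq> 0"
  shows "equivalent_ops (coord_ops W V) (coord_ops (roty l ` W) (rotx l ` V))"
proof -
  define C where "C = mat2 (l/2 + 1/(2*l)) (\<i> * (l/2 - 1/(2*l))) (- \<i> * (l/2 - 1/(2*l))) (l/2 + 1/(2*l))"
  have "C \<in> O2C"
    using assms by (simp add: O2C_def C_def mat_entries mat_def field_simps power2_eq_square)
  moreover have "hact C 1 (xmat x) = xmat (rotx l x)" for x
    by (cases x) (simp only: C_def hact_general, simp add: power_divide norm_divide norm_mult power_mult_distrib)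
  moreover have "sact C (ymat y) = ymat (roty l y)" for y
    using assms by (cases y) (simp only: C_def sact_general, simp add: power_divide power_mult_distrib)
  ultimately show ?thesis
    unfolding equivalent_ops_iff using opact_coord_ops by blast
qed

text \<open>The reflection diag(1, -1) exchanges z0 and its conjugate. Together with the rotations
  of \<open>equivalent_rot\<close> it generates O(2, C).\<close>

lemma equivalent_swap: "equivalent_ops (coord_ops W V) (coord_ops (swapy ` W) (swapx ` V))"
proof -
  define C where "C = mat2 1 0 0 (-1)"
  have "C \<in> O2C"
    by (simp add: O2C_def C_def mat_entries mat_def)
  moreover have "hact C 1 (xmat x) = xmat (swapx x)" for x
    by (cases x) (simp add: C_def hact_def xmat.simps mat_entries algebra_simps)
  moreover have "sact C (ymat y) = ymat (swapy y)" for y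
    by (cases y) (simp add: C_def sact_def ymat.simps mat_entries algebra_simps)
  ultimately show ?thesis
    unfolding equivalent_ops_iff using opact_coord_ops by blast
qed

text \<open>Transport of structure along maps that respect the three products. It keeps the
  conditions on V available after W has been moved to a standard position.\<close>

lemma multialg_image:
  assumes M: "multialg W V"
    and f: "linear f" and g: "\<And>y y'. g (y + y') = g y + g y'" "\<And>c y. g (cmul c y) = cmul c (g y)"
    and e: "\<And>x x'. xprod (f x) (f x') = g (xprod x x')" "\<And>y y'. yprod (g y) (g y') = g (yprod y y')"
      "\<And>y x. yact (g y) (f x) = f (yact y x)"
  shows "multialg (g ` W) (f ` V)"
proof -
  have V: "subspace V" and W: "0 \<in> W" "\<And>y y'. y \<in> W \<Longrightarrow> y' \<in> W \<Longrightarrow> y + y' \<in> W"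
      "\<And>c y. y \<in> W \<Longrightarrow> cmul c y \<in> W"
    and abc: "\<And>x x'. x \<in> V \<Longrightarrow> x' \<in> V \<Longrightarrow> xprod x x' \<in> W"
      "\<And>y y'. y \<in> W \<Longrightarrow> y' \<in> W \<Longrightarrow> yprod y y' \<in> W"
      "\<And>x y. y \<in> W \<Longrightarrow> x \<in> V \<Longrightarrow> yact y x \<in> V"
    using M unfolding multialg_def by blast+
  have "g 0 = 0" using g(1)[of 0 0] by simp
  then have "0 \<in> g ` W" using W(1) by (metis imageI)
  then show ?thesis
    unfolding multialg_def
    by (simp add: linear_subspace_image[OF f V] W(2,3) abc e imageI flip: g)
qed

lemma multialg_rot: "l \<noteq> 0 \<Longrightarrow> multialg W V \<Longrightarrow> multialg (roty l ` W) (rotx l ` V)"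
proof (erule multialg_image)
  assume l: "l \<noteq> 0"
  have n: "(complex_of_real (cmod l))\<^sup>2 = l * cnj l"
    using complex_norm_square[of l] by simp
  show "linear (rotx l)"
    by (rule linearI) (auto simp: field_simps add_divide_distrib scaleR_conv_of_real[where 'a=complex])
  show "roty l (y + y') = roty l y + roty l y'" "roty l (cmul c y) = cmul c (roty l y)" for y y' c
    by (cases y; cases y'; auto simp: algebra_simps add_divide_distrib)+
  show "xprod (rotx l x) (rotx l x') = roty l (xprod x x')" for x x'
    using l by (cases x; cases x') (simp add: n divide_simps, simp add: power2_eq_square algebra_simps)
  show "yprod (roty l y) (roty l y') = roty l (yprod y y')" for y y'
    using l by (cases y; cases y') (simp add: divide_simps, simp add: algebra_simps)
  show "yact (roty l y) (rotx l x) = rotx l (yact y x)" for y x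
  proof -
    obtain y' u w a b g where [simp]: "y = (y', u, w)" "x = (a, b, g)"
      by (cases y; cases x)
    have "l\<^sup>2 * u * cnj (l / cnj l * g) = of_real ((cmod l)\<^sup>2) * (u * cnj g)"
      using l by (simp add: n divide_simps) (simp add: power2_eq_square)
    moreover have "w / l\<^sup>2 * (l / cnj l * g) = w * g / of_real ((cmod l)\<^sup>2)"
      using l by (simp add: n divide_simps) (simp add: power2_eq_square)
    moreover have "2 * of_real (Re y') * (l / cnj l * g) + l\<^sup>2 * u * of_real (b / (cmod l)\<^sup>2)
          + cnj (w / l\<^sup>2) * of_real ((cmod l)\<^sup>2 * a)
        = l / cnj l * (2 * of_real (Re y') * g + u * of_real b + cnj w * of_real a)"
      using l by (simp add: n divide_simps) (simp add: power2_eq_square algebra_simps)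
    ultimately show ?thesis
      by (simp only: \<open>y = _\<close> \<open>x = _\<close> roty.simps rotx.simps yact.simps prod.inject Re_divide_of_real
           Re_complex_of_real times_complex.sel Im_complex_of_real)
         (simp add: algebra_simps add_divide_distrib diff_divide_distrib)
  qed
qed

lemma multialg_swap: "multialg W V \<Longrightarrow> multialg (swapy ` W) (swapx ` V)"
proof (erule multialg_image)
  show "linear swapx"
    by (rule linearI) auto
  show "swapy (y + y') = swapy y + swapy y'" "swapy (cmul c y) = cmul c (swapy y)" for y y' c
    by (cases y; cases y'; auto)+
  show "xprod (swapx x) (swapx x') = swapy (xprod x x')" for x x'
    by (cases x; cases x') (simp add: algebra_simps)
  show "yprod (swapy y) (swapy y') = swapy (yprod y y')" for y y'
    by (cases y; cases y') (simp add: algebra_simps)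
  show "yact (swapy y) (swapx x) = swapx (yact y x)" for y x
    by (cases y; cases x) (simp add: algebra_simps)
qed

lemma multialgD:
  assumes "multialg W V"
  shows "subspace V" "0 \<in> V" "\<And>x x'. x \<in> V \<Longrightarrow> x' \<in> V \<Longrightarrow> x + x' \<in> V" "\<And>r x. x \<in> V \<Longrightarrow> r *\<^sub>R x \<in> V"
    "0 \<in> W" "\<And>y y'. y \<in> W \<Longrightarrow> y' \<in> W \<Longrightarrow> y + y' \<in> W" "\<And>c y. y \<in> W \<Longrightarrow> cmul c y \<in> W"
    "\<And>x x'. x \<in> V \<Longrightarrow> x' \<in> V \<Longrightarrow> xprod x x' \<in> W"
    "\<And>y y'. y \<in> W \<Longrightarrow> y' \<in> W \<Longrightarrow> yprod y y' \<in> W"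
    "\<And>y x. y \<in> W \<Longrightarrow> x \<in> V \<Longrightarrow> yact y x \<in> V"
proof -
  show V: "subspace V" using assms unfolding multialg_def by (elim conjE)
  show "0 \<in> V" "\<And>x x'. x \<in> V \<Longrightarrow> x' \<in> V \<Longrightarrow> x + x' \<in> V" "\<And>r x. x \<in> V \<Longrightarrow> r *\<^sub>R x \<in> V"
    using V by (simp_all add: subspace_0 subspace_add subspace_scale)
qed (use assms in \<open>unfold multialg_def, elim conjE, simp\<close>)+

section \<open>The symmetric part\<close>

text \<open>A line off both axes is spanned by (u, w) with u w nonzero; division by a square root of
  u w normalises the product to 1. This is the form that a rotation with l^2 = 1/u later takes to
  the line of (1, 1).\<close>

lemma complex_subspaces_plane:
  fixes T :: "(complex \<times> complex) set"
  assumes 0: "(0, 0) \<in> T"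
    and add: "\<And>a b c d. (a, b) \<in> T \<Longrightarrow> (c, d) \<in> T \<Longrightarrow> (a + c, b + d) \<in> T"
    and mult: "\<And>t a b. (a, b) \<in> T \<Longrightarrow> (t * a, t * b) \<in> T"
  shows "T = {(0, 0)} \<or> T = range (\<lambda>t. (t, 0)) \<or> T = range (\<lambda>t. (0, t))
    \<or> (\<exists>u w. u * w = 1 \<and> T = range (\<lambda>t. (t * u, t * w))) \<or> T = UNIV"
proof (cases "T = {(0, 0)}")
  case False
  then obtain u w where uw: "(u, w) \<in> T" "u \<noteq> 0 \<or> w \<noteq> 0" using 0 by auto
  show ?thesis
  proof (cases "\<exists>u' w'. (u', w') \<in> T \<and> u * w' - u' * w \<noteq> 0")
    case True
    then obtain u' w' where *: "(u', w') \<in> T" "u * w' - u' * w \<noteq> 0" by blast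
    define D where "D = u * w' - u' * w"
    have "(a, b) \<in> T" for a b
    proof -
      \<comment> \<open>Cramer's rule for (a, b) in the basis (u, w), (u', w').\<close>
      have "((a * w' - b * u') / D * u + (u * b - w * a) / D * u',
             (a * w' - b * u') / D * w + (u * b - w * a) / D * w') \<in> T"
        by (intro add mult uw *)
      moreover have "(a * w' - b * u') * u + (u * b - w * a) * u' = a * D"
        "(a * w' - b * u') * w + (u * b - w * a) * w' = b * D"
        by (simp_all add: D_def algebra_simps)
      moreover have "D \<noteq> 0" using * by (simp add: D_def)
      ultimately show ?thesis
        by (simp add: add_divide_distrib[symmetric])
    qed
    then show ?thesis by auto
  next
    case False
    have T: "T = range (\<lambda>t. (t * u, t * w))"
    proof
      show "range (\<lambda>t. (t * u, t * w)) \<subseteq> T" using mult uw by auto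
      show "T \<subseteq> range (\<lambda>t. (t * u, t * w))"
      proof
        fix p assume "p \<in> T"
        then obtain u' w' where p: "p = (u', w')" "u * w' = u' * w"
          using False by (cases p) auto
        show "p \<in> range (\<lambda>t. (t * u, t * w))"
        proof (cases "u = 0")
          case True
          then have "p = (\<lambda>t. (t * u, t * w)) (w' / w)" using uw p by auto
          then show ?thesis by blast
        next
          case False
          then have "p = (\<lambda>t. (t * u, t * w)) (u' / u)" using p by (auto simp: field_simps)
          then show ?thesis by blast
        qed
      qed
    qed
    have scale: "range (\<lambda>t. (t * u, t * w)) = range (\<lambda>t. (t * (u / r), t * (w / r)))" if "r \<noteq> 0" for r
    proof (intro set_eqI iffI)
      fix p
      show "p \<in> range (\<lambda>t. (t * (u / r), t * (w / r)))" if "p \<in> range (\<lambda>t. (t * u, t * w))"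
      proof -
        from that obtain t where "p = (t * u, t * w)" by blast
        then have "p = (\<lambda>t. (t * (u / r), t * (w / r))) (t * r)" using \<open>r \<noteq> 0\<close> by simp
        then show ?thesis by blast
      qed
      show "p \<in> range (\<lambda>t. (t * u, t * w))" if "p \<in> range (\<lambda>t. (t * (u / r), t * (w / r)))"
      proof -
        from that obtain t where "p = (t * (u / r), t * (w / r))" by blast
        then have "p = (\<lambda>t. (t * u, t * w)) (t / r)" using \<open>r \<noteq> 0\<close> by simp
        then show ?thesis by blast
      qed
    qed
    consider "w = 0" "u \<noteq> 0" | "u = 0" "w \<noteq> 0" | "u \<noteq> 0" "w \<noteq> 0" using uw by blast
    then show ?thesis
    proof cases
      case 1
      then have "T = range (\<lambda>t. (t, 0))" using scale[of u] T by simp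
      then show ?thesis by blast
    next
      case 2
      then have "T = range (\<lambda>t. (0, t))" using scale[of w] T by simp
      then show ?thesis by blast
    next
      case 3
      define r where "r = csqrt (u * w)"
      have r: "r * r = u * w" using power2_csqrt[of "u * w"] by (simp add: r_def power2_eq_square)
      with 3 have r0: "r \<noteq> 0" by auto
      have "u / r * (w / r) = 1" using 3 r r0 by (simp add: field_simps)
      moreover have "T = range (\<lambda>t. (t * (u / r), t * (w / r)))" using scale[OF r0] T by simp
      ultimately show ?thesis by blast
    qed
  qed
qed simp

text \<open>The form y^2 - u w is a nondegenerate quadratic form in three complex variables, so its
  totally isotropic subspaces have dimension at most one.\<close>

lemma isotropic_collinear:
  fixes y :: complex
  assumes "y * y = u * w" "y' * y' = u' * w'" "2 * y * y' = u * w' + u' * w" "(y, u, w) \<noteq> (0, 0, 0)"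
  shows "\<exists>t. (y', u', w') = cmul t (y, u, w)"
proof -
  \<comment> \<open>By the hypotheses the right-hand side is 4 (y y')^2 - 4 y^2 y'^2.\<close>
  have "(u * w' - u' * w) * (u * w' - u' * w) = (u * w' + u' * w) * (u * w' + u' * w) - 4 * ((u * w) * (u' * w'))"
    by (simp add: algebra_simps)
  also have "\<dots> = 0"
    unfolding assms(1,2,3)[symmetric] by (simp add: algebra_simps)
  finally have 1: "u * w' = u' * w" by simp
  have 2: "y * y' = u * w'" using assms(3) 1 by simp
  show ?thesis
  proof (cases "u = 0")
    case True
    then have y: "y = 0" "w \<noteq> 0" using assms by auto
    then have "u' = 0" using 1 True by simp
    then have "y' = 0" using assms(2) by simp
    then show ?thesis using True y \<open>u' = 0\<close> by (intro exI[of _ "w' / w"]) simp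
  next
    case False
    have "y' * u = u' * y"
    proof (cases "y = 0")
      case True
      then have "w = 0" using assms(1) False by simp
      then have "w' = 0" using 1 False by simp
      then show ?thesis using assms(2) True by simp
    next
      case y: False
      have "y * (y' * u) = u * (y * y')" by simp
      also have "\<dots> = u * (u' * w)" using 1 2 by simp
      also have "\<dots> = y * (u' * y)" using assms(1) by (simp add: algebra_simps)
      finally show ?thesis using y by simp
    qed
    then show ?thesis using False 1
      by (intro exI[of _ "u' / u"]) (simp add: field_simps)
  qed
qed

text \<open>Two pairs among the nine shapes are exchanged by the reflection, the lines of N and of
  its conjugate and the planes that I spans with them. This leaves the seven W of the list.\<close>

lemma jordan_algebras_classification:
  assumes M: "multialg W V"
  shows "W = {(0, 0, 0)} \<or> W = range (\<lambda>t. (t, 0, 0)) \<or> (\<exists>u w. u * w = 1 \<and> W = range (\<lambda>t. (t, t * u, t * w)))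
    \<or> W = range (\<lambda>t. (0, t, 0)) \<or> W = range (\<lambda>t. (0, 0, t))
    \<or> (\<exists>u w. u * w = 1 \<and> W = {(y, t * u, t * w) | y t. True})
    \<or> W = {(y, u, 0) | y u. True} \<or> W = {(y, 0, w) | y w. True} \<or> W = UNIV"
proof -
  note D = multialgD[OF M]
  note add = D(6) and mult = D(7) and alg = D(9)
  have 0: "(0, 0, 0) \<in> W" using D(5) by (simp add: zero_prod_def)
  show ?thesis
  proof (cases "(1, 0, 0) \<in> W")
    case True
    have shift: "(y, u, w) \<in> W \<longleftrightarrow> (0, u, w) \<in> W" for y u w
    proof
      show "(0, u, w) \<in> W" if "(y, u, w) \<in> W"
        using add[OF that mult[OF True, of "- y"]] by simp
      show "(y, u, w) \<in> W" if "(0, u, w) \<in> W"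
        using add[OF that mult[OF True, of y]] by simp
    qed
    define T where "T = {(u, w). (0, u, w) \<in> W}"
    have W: "W = {(y, u, w) | y u w. (u, w) \<in> T}"
    proof (rule set_eqI)
      fix p :: "complex \<times> complex \<times> complex"
      obtain y u w where "p = (y, u, w)" by (cases p)
      then show "p \<in> W \<longleftrightarrow> p \<in> {(y, u, w) | y u w. (u, w) \<in> T}"
        using shift[of y u w] by (simp add: T_def)
    qed
    have "T = {(0, 0)} \<or> T = range (\<lambda>t. (t, 0)) \<or> T = range (\<lambda>t. (0, t))
      \<or> (\<exists>u w. u * w = 1 \<and> T = range (\<lambda>t. (t * u, t * w))) \<or> T = UNIV"
    proof (rule complex_subspaces_plane)
      show "(0, 0) \<in> T" using 0 by (simp add: T_def)
      show "(a + c, b + d) \<in> T" if "(a, b) \<in> T" "(c, d) \<in> T" for a b c d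
        using add[of "(0, a, b)" "(0, c, d)"] that by (simp add: T_def)
      show "(t * a, t * b) \<in> T" if "(a, b) \<in> T" for t a b
        using mult[of "(0, a, b)" t] that by (simp add: T_def)
    qed
    then show ?thesis
    proof (elim disjE exE conjE)
      assume "T = {(0, 0)}"
      then have "W = range (\<lambda>t. (t, 0, 0))" using W by auto
      then show ?thesis by blast
    next
      assume "T = range (\<lambda>t. (t, 0))"
      then have "W = {(y, u, 0) | y u. True}" using W by auto
      then show ?thesis by blast
    next
      assume "T = range (\<lambda>t. (0, t))"
      then have "W = {(y, 0, w) | y w. True}" using W by auto
      then show ?thesis by blast
    next
      fix u w assume uw: "u * w = 1" "T = range (\<lambda>t. (t * u, t * w))"
      have "W = {(y, t * u, t * w) | y t. True}" unfolding W uw(2) image_iff by auto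
      then have "\<exists>u w. u * w = 1 \<and> W = {(y, t * u, t * w) | y t. True}"
        using uw(1) by (intro exI conjI)
      then show ?thesis by (simp only: simp_thms)
    next
      assume "T = UNIV"
      then have "W = UNIV" using W by auto
      then show ?thesis by blast
    qed
  next
    case False
    have pol: "2 * y * y' = u * w' + u' * w" if "(y, u, w) \<in> W" "(y', u', w') \<in> W" for y u w y' u' w'
    proof (rule ccontr)
      assume ne: "2 * y * y' \<noteq> u * w' + u' * w"
      \<comment> \<open>Polarised Cayley-Hamilton: removing the trace terms from the Jordan product
        leaves a multiple of I, and its coefficient is minus the polar form of y^2 - u w. Without I
        in W this form has to vanish.\<close>
      have "yprod (y, u, w) (y', u', w') + (cmul (- 2 * y) (y', u', w') + cmul (- 2 * y') (y, u, w)) \<in> W"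
        by (intro add alg mult that)
      then have "(u * w' + u' * w - 2 * y * y', 0, 0) \<in> W"
        by (simp add: algebra_simps)
      from mult[OF this, of "1 / (u * w' + u' * w - 2 * y * y')"] show False
        using ne False by simp
    qed
    have iso: "y * y = u * w" if "(y, u, w) \<in> W" for y u w
      using pol[OF that that] by simp
    show ?thesis
    proof (cases "W = {(0, 0, 0)}")
      case W0: False
      then obtain y u w where y: "(y, u, w) \<in> W" "(y, u, w) \<noteq> (0, 0, 0)" using 0 by auto
      have W: "W = range (\<lambda>t. cmul t (y, u, w))"
      proof
        show "range (\<lambda>t. cmul t (y, u, w)) \<subseteq> W" using mult[OF y(1)] by blast
        show "W \<subseteq> range (\<lambda>t. cmul t (y, u, w))"
        proof
          fix p assume p: "p \<in> W"
          obtain y' u' w' where "p = (y', u', w')" by (cases p)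
          then show "p \<in> range (\<lambda>t. cmul t (y, u, w))"
            using isotropic_collinear[of y u w y' u' w'] iso pol p y by blast
        qed
      qed
      have scale: "W = range (\<lambda>t. cmul t (cmul (1 / r) (y, u, w)))" if "r \<noteq> 0" for r
      proof (intro set_eqI iffI)
        fix p
        show "p \<in> range (\<lambda>t. cmul t (cmul (1 / r) (y, u, w)))" if "p \<in> W"
        proof -
          from that obtain t where "p = cmul t (y, u, w)" using W by blast
          then have "p = (\<lambda>t. cmul t (cmul (1 / r) (y, u, w))) (t * r)" using \<open>r \<noteq> 0\<close> by simp
          then show ?thesis by blast
        qed
        show "p \<in> W" if "p \<in> range (\<lambda>t. cmul t (cmul (1 / r) (y, u, w)))"
          using that mult y(1) by blast
      qed
      \<comment> \<open>The coordinate y is a quarter of the trace. If it is zero, the spanning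
        matrix is nilpotent and a multiple of N or of its conjugate; otherwise it is rescaled to y =
        1, and isotropy becomes u w = 1.\<close>
      show ?thesis
      proof (cases "y = 0")
        case True
        then consider "w = 0" "u \<noteq> 0" | "u = 0" "w \<noteq> 0" using iso[OF y(1)] y(2) by auto
        then show ?thesis
        proof cases
          case 1
          then have "W = range (\<lambda>t. (0, t, 0))" using scale[of u] True by simp
          then show ?thesis by blast
        next
          case 2
          then have "W = range (\<lambda>t. (0, 0, t))" using scale[of w] True by simp
          then show ?thesis by blast
        qed
      next
        case y0: False
        have "u / y * (w / y) = u * w / (y * y)" by simp
        also have "\<dots> = 1" using y0 by (simp flip: iso[OF y(1)])
        finally have "u / y * (w / y) = 1" .
        moreover have "W = range (\<lambda>t. (t, t * (u / y), t * (w / y)))" using scale[OF y0] y0 by simp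
        ultimately have "\<exists>u w. u * w = 1 \<and> W = range (\<lambda>t. (t, t * u, t * w))"
          by (intro exI conjI)
        then show ?thesis by (simp only: simp_thms)
      qed
    qed simp
  qed
qed

section \<open>The Hermitian part\<close>

lemma subspace_line:
  fixes v :: "'a::real_vector"
  assumes "subspace V" "V \<subseteq> range (\<lambda>t. t *\<^sub>R v)"
  shows "V = {0} \<or> V = range (\<lambda>t. t *\<^sub>R v)"
proof (cases "V = {0}")
  case False
  then obtain x where x: "x \<in> V" "x \<noteq> 0" using subspace_0[OF assms(1)] by blast
  then obtain s where s: "x = s *\<^sub>R v" using assms(2) by blast
  have "t *\<^sub>R v \<in> V" for t
  proof -
    have "(t / s) *\<^sub>R x \<in> V" using assms(1) x(1) by (rule subspace_scale)
    then show ?thesis using x s by simp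
  qed
  then have "V = range (\<lambda>t. t *\<^sub>R v)" using assms(2) by blast
  then show ?thesis ..
qed simp

lemma triples_line:
  fixes V :: "(real \<times> real \<times> complex) set"
  assumes "subspace V" "\<And>a b g. (a, b, g) \<in> V \<Longrightarrow> \<exists>t. (a, b, g) = t *\<^sub>R v"
  shows "V = {0} \<or> V = range (\<lambda>t. t *\<^sub>R v)"
proof (rule subspace_line[OF assms(1)], rule subsetI)
  fix p assume "p \<in> V"
  then show "p \<in> range (\<lambda>t. t *\<^sub>R v)" using assms(2) by (cases p) blast
qed

lemma real_subspaces_complex:
  fixes S :: "complex set"
  assumes S: "subspace S"
  shows "S = {0} \<or> (\<exists>c. c \<noteq> 0 \<and> S = range (\<lambda>t. of_real t * c)) \<or> S = UNIV"
proof (cases "S = {0}")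
  case False
  then obtain c where c: "c \<in> S" "c \<noteq> 0" using subspace_0[OF S] by blast
  show ?thesis
  proof (cases "\<exists>d\<in>S. Im (d / c) \<noteq> 0")
    case True
    then obtain d where d: "d \<in> S" "Im (d / c) \<noteq> 0" by blast
    define q where "q = d / c"
    have iq: "Im q \<noteq> 0" using d(2) by (simp add: q_def)
    have dq: "d = q * c" using c(2) by (simp add: q_def)
    have "z \<in> S" for z
    proof -
      define p where "p = z / c"
      \<comment> \<open>Real coordinates of p = z/c in the basis 1, q, multiplied back by c.\<close>
      have "(Re p - Im p / Im q * Re q) *\<^sub>R c + (Im p / Im q) *\<^sub>R d \<in> S"
        using S c(1) d(1) by (intro subspace_add subspace_scale)
      moreover have "of_real (Re p - Im p / Im q * Re q) + of_real (Im p / Im q) * q = p"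
        using iq by (simp add: complex_eq_iff)
      then have "(Re p - Im p / Im q * Re q) *\<^sub>R c + (Im p / Im q) *\<^sub>R d = p * c"
        unfolding dq by (metis (no_types, lifting) distrib_right mult.assoc scaleR_conv_of_real)
      ultimately show ?thesis using c(2) by (simp add: p_def)
    qed
    then show ?thesis by blast
  next
    case False
    have "S = range (\<lambda>t. of_real t * c)"
    proof
      show "range (\<lambda>t. of_real t * c) \<subseteq> S"
        using subspace_scale[OF S c(1)] by (auto simp: scaleR_conv_of_real)
      show "S \<subseteq> range (\<lambda>t. of_real t * c)"
      proof
        fix d assume "d \<in> S"
        then have "Im (d / c) = 0" using False by blast
        then have "d / c = of_real (Re (d / c))" by (simp add: complex_eq_iff)
        then have "d = of_real (Re (d / c)) * c" using c(2) by (metis nonzero_divide_eq_eq)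
        then show "d \<in> range (\<lambda>t. of_real t * c)" by blast
      qed
    qed
    then show ?thesis using c(2) by blast
  qed
qed simp

section \<open>The possible V for each standard W\<close>

lemma multialg_0_cases:
  assumes "multialg {0} V"
  shows "V = {0} \<or> V = range (\<lambda>a. (a, 0, 0)) \<or> V = range (\<lambda>b. (0, b, 0))"
proof -
  note M = multialgD[OF assms]
  \<comment> \<open>Here X X^T = 0, with coordinates 2ab + 2|g|^2, 4ag and 4b cnj g. A nonzero g
    would force a = b = 0 and then |g|^2 = 0.\<close>
  have elt: "g = 0 \<and> a * b = 0" if "(a, b, g) \<in> V" for a b g
  proof -
    show ?thesis
      using M(8)[OF that that] by (cases "g = 0") (auto simp: zero_prod_def)
  qed
  have "(\<forall>(a, b, g)\<in>V. b = 0) \<or> (\<forall>(a, b, g)\<in>V. a = 0)"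
  proof (rule ccontr)
    assume "\<not> ?thesis"
    then obtain a b g a' b' g' where *: "(a, b, g) \<in> V" "b \<noteq> 0" "(a', b', g') \<in> V" "a' \<noteq> 0" by auto
    then have "(a', b, 0) \<in> V" using M(3)[OF *(1,3)] elt[OF *(1)] elt[OF *(3)] by auto
    from elt[OF this] *(2,4) show False by simp
  qed
  then show ?thesis
  proof
    assume *: "\<forall>(a, b, g)\<in>V. b = 0"
    have "V = {0} \<or> V = range (\<lambda>t. t *\<^sub>R (1, 0, 0))"
    proof (rule triples_line[OF M(1)])
      show "\<exists>t. (a, b, g) = t *\<^sub>R (1, 0, 0)" if "(a, b, g) \<in> V" for a b g
        using that * elt[OF that] by auto
    qed
    then show ?thesis by auto
  next
    assume *: "\<forall>(a, b, g)\<in>V. a = 0"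
    have "V = {0} \<or> V = range (\<lambda>t. t *\<^sub>R (0, 1, 0))"
    proof (rule triples_line[OF M(1)])
      show "\<exists>t. (a, b, g) = t *\<^sub>R (0, 1, 0)" if "(a, b, g) \<in> V" for a b g
        using that * elt[OF that] by auto
    qed
    then show ?thesis by auto
  qed
qed

text \<open>Multiples of I act on V as real scalars, while X X^T is scalar exactly if ag = bg = 0.
  So V is a real subspace of one of the planes g = 0 and a = b = 0, which accounts for the families
  of lines.\<close>

lemma multialg_I_cases:
  assumes "multialg (range (\<lambda>t. (t, 0, 0))) V"
  shows "V = {0} \<or> (\<exists>a b. (a, b) \<noteq> (0, 0) \<and> V = range (\<lambda>t. (t * a, t * b, 0))) \<or> V = {(a, b, 0) | a b. True}
    \<or> (\<exists>c. c \<noteq> 0 \<and> V = range (\<lambda>t. (0, 0, of_real t * c))) \<or> V = range (\<lambda>c. (0, 0, c))"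
proof -
  note M = multialgD[OF assms]
  have elt: "(a = 0 \<and> b = 0) \<or> g = 0" if "(a, b, g) \<in> V" for a b g
    using M(8)[OF that that] by auto
  have "(\<forall>(a, b, g)\<in>V. a = 0 \<and> b = 0) \<or> (\<forall>(a, b, g)\<in>V. g = 0)"
  proof (rule ccontr)
    assume "\<not> ?thesis"
    then obtain a b g a' b' g' where *: "(a, b, g) \<in> V" "\<not> (a = 0 \<and> b = 0)" "(a', b', g') \<in> V" "g' \<noteq> 0" by fast
    then have "(a, b, g') \<in> V" using M(3)[OF *(1,3)] elt[OF *(1)] elt[OF *(3)] by auto
    then show False using elt * by blast
  qed
  then show ?thesis
  proof
    assume V0: "\<forall>(a, b, g)\<in>V. a = 0 \<and> b = 0"
    define S where "S = {c. (0, 0, c) \<in> V}"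
    have V: "V = (\<lambda>c. (0, 0, c)) ` S" using V0 by (auto simp: S_def)
    have "subspace S"
      using M(2,3,4) unfolding subspace_def S_def by (fastforce simp: zero_prod_def)
    from real_subspaces_complex[OF this] show ?thesis
    proof (elim disjE exE conjE)
      assume "S = {0}" then have "V = {0}" using V by (simp add: zero_prod_def)
      then show ?thesis ..
    next
      fix c assume c: "c \<noteq> 0" "S = range (\<lambda>t. of_real t * c)"
      then have "V = range (\<lambda>t. (0, 0, of_real t * c))" using V by (simp add: image_image)
      then have "\<exists>c. c \<noteq> 0 \<and> V = range (\<lambda>t. (0, 0, of_real t * c))" using c(1) by (intro exI conjI)
      then show ?thesis by (simp only: simp_thms)
    next
      assume "S = UNIV" then have "V = range (\<lambda>c. (0, 0, c))" using V by simp
      then show ?thesis by (simp only: simp_thms)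
    qed
  next
    assume V0: "\<forall>(a, b, g)\<in>V. g = 0"
    \<comment> \<open>The plane g = 0 is identified with the complex numbers by a + ib, which makes
      \<open>real_subspaces_complex\<close> applicable.\<close>
    define S where "S = {c. (Re c, Im c, 0) \<in> V}"
    have V: "V = (\<lambda>c. (Re c, Im c, 0)) ` S"
    proof
      show "(\<lambda>c. (Re c, Im c, 0)) ` S \<subseteq> V" by (auto simp: S_def)
      show "V \<subseteq> (\<lambda>c. (Re c, Im c, 0)) ` S"
      proof clarify
        fix a b g assume *: "(a, b, g) \<in> V"
        then have "(a, b, g) = (\<lambda>c. (Re c, Im c, 0)) (Complex a b)" using V0 by auto
        moreover from this have "Complex a b \<in> S" using * by (simp add: S_def)
        ultimately show "(a, b, g) \<in> (\<lambda>c. (Re c, Im c, 0)) ` S" by (rule image_eqI)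
      qed
    qed
    have "subspace S"
      using M(2,3,4) unfolding subspace_def S_def by (fastforce simp: zero_prod_def)
    from real_subspaces_complex[OF this] show ?thesis
    proof (elim disjE exE conjE)
      assume "S = {0}" then have "V = {0}" using V by (simp add: zero_prod_def)
      then show ?thesis ..
    next
      fix c assume c: "c \<noteq> 0" "S = range (\<lambda>t. of_real t * c)"
      then have "V = range (\<lambda>t. (t * Re c, t * Im c, 0))" using V by (simp add: image_image)
      moreover have "(Re c, Im c) \<noteq> (0, 0)" using c(1) by (simp add: complex_eq_iff)
      ultimately have "\<exists>a b. (a, b) \<noteq> (0, 0) \<and> V = range (\<lambda>t. (t * a, t * b, 0))" by (intro exI conjI)
      then show ?thesis by (simp only: simp_thms)
    next
      assume "S = UNIV"
      then have "V = {(a, b, 0) | a b. True}" using V by (auto simp: image_iff) (metis complex.sel)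
      then show ?thesis by (simp only: simp_thms)
    qed
  qed
qed

text \<open>The product condition on single elements does not suffice: it also admits Z0, since Z0
  Z0^T = 0. Closure of V under the action of W excludes it.\<close>

lemma multialg_e_cases:
  assumes "multialg (range (\<lambda>t. (t, t, t))) V"
  shows "V = {0} \<or> V = range (\<lambda>a. (a, a, of_real a))"
proof -
  note M = multialgD[OF assms]
  have elt: "of_real (a * b) + g * cnj g = 2 * (of_real a * g) \<and> of_real a * g = of_real b * cnj g"
    if "(a, b, g) \<in> V" for a b g
    using M(8)[OF that that] by (auto simp: image_iff; algebra)
  have "a = b \<and> g = of_real a" if x: "(a, b, g) \<in> V" for a b g
  proof -
    \<comment> \<open>The image under \<open>i e\<^sub>1e\<^sub>1\<^sup>T\<close> must satisfy the same equations too, and this forces it to vanish.\<close>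
    have "yact (\<i>, \<i>, \<i>) (a, b, g) \<in> V" by (rule M(10)) (use x in auto)
    then have "(2 * Im g, - (2 * Im g), \<i> * of_real (b - a)) \<in> V" by (simp add: algebra_simps)
    from conjunct1[OF elt[OF this]] have "(b - a)^2 = 4 * (Im g)^2" "(Im g) * (b - a) = 0"
      by (auto simp: complex_eq_iff power2_eq_square algebra_simps)
    then have 1: "Im g = 0" "a = b" by auto
    then have "a * a + Re g * Re g = 2 * a * Re g"
      using elt[OF x] by (simp add: complex_eq_iff)
    then have "(a - Re g)^2 = 0" by (simp add: power2_eq_square algebra_simps)
    then show ?thesis using 1 by (simp add: complex_eq_iff)
  qed
  then have "\<exists>t. (a, b, g) = t *\<^sub>R (1, 1, 1)" if "(a, b, g) \<in> V" for a b g
    using that by (intro exI[of _ a]) (auto simp: scaleR_conv_of_real)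
  from triples_line[OF M(1) this] show ?thesis by (simp add: scaleR_conv_of_real)
qed

lemma multialg_z_cases:
  assumes "multialg (range (\<lambda>t. (0, t, 0))) V"
  shows "V = {0} \<or> V = range (\<lambda>a. (a, 0, 0))"
proof -
  note M = multialgD[OF assms]
  have elt: "of_real (a * b) + g * cnj g = 0" if "(a, b, g) \<in> V" for a b g
    using M(8)[OF that that] by auto
  have "b = 0 \<and> g = 0" if x: "(a, b, g) \<in> V" for a b g
  proof -
    \<comment> \<open>N takes the triple to (2 Re g, 0, b), for which the product condition reads
      b^2 = 0.\<close>
    have "yact (0, 1, 0) (a, b, g) \<in> V" by (rule M(10)) (use x in auto)
    from elt[OF this[simplified]] have "b = 0" by simp
    then show ?thesis using elt[OF x] by simp
  qed
  then have "\<exists>t. (a, b, g) = t *\<^sub>R (1, 0, 0)" if "(a, b, g) \<in> V" for a b g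
    using that by (intro exI[of _ a]) auto
  from triples_line[OF M(1) this] show ?thesis by simp
qed

text \<open>Triples with a = b and real g are the diagonal matrices, those with a = -b and imaginary
  g the off-diagonal Hermitian ones. The maps \<open>swap\<close> and \<open>turn\<close> below come
  from diag(1, -1) and i diag(1, -1). The former kills the off-diagonal part and negates the second
  diagonal entry; the latter kills the diagonal and is a complex structure on the off-diagonal part.
  Their squares are, up to sign, the two projections, so V splits.\<close>

lemma multialg_D_cases:
  assumes "multialg {(y, t, t) | y t. True} V"
  shows "V = {0} \<or> V = range (\<lambda>a. (a, a, of_real a)) \<or> V = range (\<lambda>a. (a, a, - of_real a))
    \<or> V = {(a, a, of_real r) | a r. True} \<or> V = {(- x, x, \<i> * of_real y) | x y. True}"
proof -
  note M = multialgD[OF assms]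
  have elt: "of_real a * g' + of_real a' * g = of_real b * cnj g' + of_real b' * cnj g"
    if "(a, b, g) \<in> V" "(a', b', g') \<in> V" for a b g a' b' g'
    using M(8)[OF that] by (auto; algebra)
  have swap: "(Re g, Re g, of_real ((a + b) / 2)) \<in> V" if "(a, b, g) \<in> V" for a b g
  proof -
    have "(1/2) *\<^sub>R yact (0, 1, 1) (a, b, g) \<in> V" by (intro M(4) M(10)) (use that in auto)
    then show ?thesis by (simp add: scaleR_conv_of_real algebra_simps)
  qed
  have turn: "(Im g, - Im g, \<i> * of_real ((b - a) / 2)) \<in> V" if "(a, b, g) \<in> V" for a b g
  proof -
    have "(1/2) *\<^sub>R yact (0, \<i>, \<i>) (a, b, g) \<in> V" by (intro M(4) M(10)) (use that in auto)
    then show ?thesis by (simp add: scaleR_conv_of_real algebra_simps diff_divide_distrib)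
  qed
  have diag: "((a + b) / 2, (a + b) / 2, of_real (Re g)) \<in> V" if "(a, b, g) \<in> V" for a b g
    using swap[OF swap[OF that]] by simp
  have offd: "(- ((b - a) / 2), (b - a) / 2, \<i> * of_real (Im g)) \<in> V" if "(a, b, g) \<in> V" for a b g
  proof -
    \<comment> \<open>This is \<open>turn\<close> applied twice; its square is minus the projection
      onto the off-diagonal part, hence the factor -1.\<close>
    have "(-1) *\<^sub>R (Im (\<i> * of_real ((b - a) / 2)), - Im (\<i> * of_real ((b - a) / 2)), \<i> * of_real ((- Im g - Im g) / 2)) \<in> V"
      by (intro M(4) turn that)
    moreover have "(-1) *\<^sub>R (Im (\<i> * of_real ((b - a) / 2)), - Im (\<i> * of_real ((b - a) / 2)), \<i> * of_real ((- Im g - Im g) / 2))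
        = (- ((b - a) / 2), (b - a) / 2, \<i> * of_real (Im g))"
      by simp argo
    ultimately show ?thesis by (simp only:)
  qed
  have excl: "(r = 0 \<and> s = 0) \<or> (x = 0 \<and> y = 0)"
    if "(r, r, of_real s) \<in> V" "(- x, x, \<i> * of_real y) \<in> V" for r s x y
  proof -
    \<comment> \<open>The off-diagonal element is paired with the diagonal one and with its image
      under \<open>swap\<close>, which exchanges r and s; together the four products of coordinates
      vanish.\<close>
    have "r * y = 0" "s * x = 0"
      using elt[OF that] by (auto simp: complex_eq_iff)
    moreover have "s * y = 0" "r * x = 0"
      using elt[OF _ that(2), of s s "of_real r"] swap[OF that(1)] by (auto simp: complex_eq_iff)
    ultimately show ?thesis by auto
  qed
  have "(\<forall>(a, b, g)\<in>V. a + b = 0 \<and> Re g = 0) \<or> (\<forall>(a, b, g)\<in>V. a = b \<and> Im g = 0)"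
  proof (rule ccontr)
    assume "\<not> ?thesis"
    then obtain a b g a' b' g' where *: "(a, b, g) \<in> V" "\<not> (a + b = 0 \<and> Re g = 0)"
      "(a', b', g') \<in> V" "\<not> (a' = b' \<and> Im g' = 0)" by fast
    from excl[OF diag[OF *(1)] offd[OF *(3)]] *(2,4) show False by auto
  qed
  then show ?thesis
  proof
    assume "\<forall>(a, b, g)\<in>V. a + b = 0 \<and> Re g = 0"
    then have sub: "a = - b \<and> g = \<i> * of_real (Im g)" if "(a, b, g) \<in> V" for a b g
      using that by (auto simp: complex_eq_iff)
    show ?thesis
    proof (cases "V = {0}")
      case False
      then obtain a b g where "(a, b, g) \<in> V" "(a, b, g) \<noteq> 0" using M(2) by auto
      then obtain x y where xy: "(- x, x, \<i> * of_real y) \<in> V" "x \<noteq> 0 \<or> y \<noteq> 0"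
        using sub by (metis mult_zero_right neg_equal_zero of_real_0 zero_prod_def minus_zero)
      have n: "x * x + y * y \<noteq> 0" using xy(2) by (simp add: sum_squares_eq_zero_iff)
      have "(- p, p, \<i> * of_real q) \<in> V" for p q
      proof -
        define N where "N = x * x + y * y"
        \<comment> \<open>P + iQ is the quotient of p + iq by x + iy. On the off-diagonal plane
          \<open>turn\<close> is multiplication by i, so one nonzero element generates the
          plane.\<close>
        define P where "P = (p * x + q * y) / N"
        define Q where "Q = (q * x - p * y) / N"
        have "N \<noteq> 0" using n by (simp add: N_def)
        from this have "P * x - Q * y = p" "P * y + Q * x = q"
          by (simp_all add: P_def Q_def divide_simps) (simp_all add: N_def algebra_simps)
        then have "(- p, p, \<i> * of_real q) = P *\<^sub>R (- x, x, \<i> * of_real y) + Q *\<^sub>R (y, - y, \<i> * of_real x)"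
          by (auto simp: complex_eq_iff)
        also have "\<dots> \<in> V"
          using turn[OF xy(1)] by (intro M(3) M(4) xy) simp
        finally show ?thesis .
      qed
      then have "V = {(- x, x, \<i> * of_real y) | x y. True}" using sub by fastforce
      then show ?thesis by (simp only: simp_thms)
    qed simp
  next
    assume "\<forall>(a, b, g)\<in>V. a = b \<and> Im g = 0"
    then have sub: "a = b \<and> of_real (Re g) = g" if "(a, b, g) \<in> V" for a b g
      using that by (auto simp: complex_eq_iff)
    \<comment> \<open>The diagonal entries of the matrix are 2(a + Re g) and 2(a - Re g). Adding the
      image under \<open>swap\<close> isolates the first, subtracting it the second.\<close>
    have plus: "(t, t, of_real t) \<in> V" if x: "(a, b, g) \<in> V" "a + Re g \<noteq> 0" for a b g t
    proof -
      have "(a + Re g) *\<^sub>R (1, 1, 1) \<in> V"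
        using M(3)[OF diag[OF x(1)] swap[OF x(1)]] sub[OF x(1)] by (simp add: scaleR_conv_of_real add.commute)
      from M(4)[OF this, of "t / (a + Re g)"] show ?thesis
        unfolding scaleR_scaleR using x(2) by (simp add: scaleR_conv_of_real)
    qed
    have minus: "(t, t, - of_real t) \<in> V" if x: "(a, b, g) \<in> V" "a - Re g \<noteq> 0" for a b g t
    proof -
      have "(a - Re g) *\<^sub>R (1, 1, -1) \<in> V"
        using M(3)[OF diag[OF x(1)] M(4)[OF swap[OF x(1)], of "-1"]] sub[OF x(1)] by (simp add: scaleR_conv_of_real)
      from M(4)[OF this, of "t / (a - Re g)"] show ?thesis
        unfolding scaleR_scaleR using x(2) by (simp add: scaleR_conv_of_real)
    qed
    have reals: "V \<subseteq> {(a, a, of_real r) | a r. True}"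
    proof
      fix p assume p: "p \<in> V"
      obtain a b g where "p = (a, b, g)" by (cases p)
      then have "p = (a, a, of_real (Re g))" using sub[of a b g] p by simp
      then show "p \<in> {(a, a, of_real r) | a r. True}" by blast
    qed
    consider "\<forall>(a, b, g)\<in>V. a + Re g = 0" | "\<forall>(a, b, g)\<in>V. a - Re g = 0"
      | a b g a' b' g' where "(a, b, g) \<in> V" "a + Re g \<noteq> 0" "(a', b', g') \<in> V" "a' - Re g' \<noteq> 0"
      by fast
    then show ?thesis
    proof cases
      case 1
      have "\<exists>t. (a, b, g) = t *\<^sub>R (1, 1, -1)" if x: "(a, b, g) \<in> V" for a b g
      proof -
        have "Re g = - a" using 1 x by force
        then have "g = - of_real a" using sub[OF x] by simp
        then show ?thesis using sub[OF x] by (intro exI[of _ a]) (simp add: scaleR_conv_of_real)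
      qed
      from triples_line[OF M(1) this] show ?thesis by (auto simp: scaleR_conv_of_real)
    next
      case 2
      have "\<exists>t. (a, b, g) = t *\<^sub>R (1, 1, 1)" if x: "(a, b, g) \<in> V" for a b g
      proof -
        have "Re g = a" using 2 x by force
        then have "g = of_real a" using sub[OF x] by simp
        then show ?thesis using sub[OF x] by (intro exI[of _ a]) (simp add: scaleR_conv_of_real)
      qed
      from triples_line[OF M(1) this] show ?thesis by (auto simp: scaleR_conv_of_real)
    next
      case 3
      have "(a, a, of_real r) \<in> V" for a r
        using M(3)[OF plus[OF 3(1,2), of "(a + r) / 2"] minus[OF 3(3,4), of "(a - r) / 2"]]
        by (simp add: field_simps)
      then have "V = {(a, a, of_real r) | a r. True}" using reals by blast
      then show ?thesis by (simp only: simp_thms)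
    qed
  qed
qed

text \<open>The last coordinate of every product must vanish. Testing a triple against its image (2
  Re g, 0, b) under N gives b^2 = 0. After that the action of multiples of N only produces multiples
  of Z0, so V is either contained in the line of Z0 or the sum of that line and a real space S of
  values of g.\<close>

lemma multialg_N_cases:
  assumes "multialg {(y, u, 0) | y u. True} V"
  shows "V = {0} \<or> V = range (\<lambda>a. (a, 0, 0)) \<or> (\<exists>c. c \<noteq> 0 \<and> V = {(a, 0, of_real t * c) | a t. True})
    \<or> V = {(a, 0, c) | a c. True}"
proof -
  note M = multialgD[OF assms]
  have elt: "of_real b * cnj g' + of_real b' * cnj g = 0"
    if "(a, b, g) \<in> V" "(a', b', g') \<in> V" for a b g a' b' g'
    using M(8)[OF that] by (auto; algebra)
  have act: "(2 * Re (u * cnj g), 0, u * of_real b) \<in> V" if "(a, b, g) \<in> V" for a b g u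
    using M(10)[of "(0, u, 0)" "(a, b, g)"] that by simp
  have b0: "b = 0" if x: "(a, b, g) \<in> V" for a b g
    using elt[OF x act[OF x, of 1]] by simp
  define S where "S = {c. \<exists>a. (a, 0, c) \<in> V}"
  have S: "subspace S"
    unfolding subspace_def
  proof (intro conjI ballI allI)
    show "0 \<in> S" using M(2) by (auto simp: S_def zero_prod_def)
    show "c + d \<in> S" if "c \<in> S" "d \<in> S" for c d using that M(3) by (fastforce simp: S_def)
    show "r *\<^sub>R c \<in> S" if "c \<in> S" for c r using that M(4) by (fastforce simp: S_def)
  qed
  show ?thesis
  proof (cases "S = {0}")
    case True
    have "c = 0" if "(a, b, c) \<in> V" for a b c
      using that b0[OF that] True unfolding S_def by blast
    then have "\<exists>t. (a, b, g) = t *\<^sub>R (1, 0, 0)" if "(a, b, g) \<in> V" for a b g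
      using that b0[OF that] by (intro exI[of _ a]) auto
    from triples_line[OF M(1) this] show ?thesis by auto
  next
    case False
    then obtain c a where "c \<noteq> 0" "(a, 0, c) \<in> V" using S subspace_0[OF S] unfolding S_def by blast
    \<comment> \<open>The choice u = c turns Re (u cnj c) into |c|^2, so Z0 lies in V.\<close>
    then have "(2 * (cmod c)^2, 0, 0) \<in> V"
      using act[of a 0 c c] by (simp add: complex_mult_cnj cmod_power2)
    from M(4)[OF this, of "t / (2 * (cmod c)^2)" for t] have a: "(t, 0, 0) \<in> V" for t
      using \<open>c \<noteq> 0\<close> by simp
    have "(a, 0, c) \<in> V" if c: "c \<in> S" for a c
    proof -
      obtain a' where "(a', 0, c) \<in> V" using c unfolding S_def by blast
      from M(3)[OF this a[of "a - a'"]] show ?thesis by simp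
    qed
    then have V: "V = {(a, 0, c) | a c. c \<in> S}" using b0 by (force simp: S_def)
    from real_subspaces_complex[OF S] False show ?thesis
    proof (elim disjE exE conjE)
      fix c assume c: "c \<noteq> 0" "S = range (\<lambda>t. of_real t * c)"
      then have "V = {(a, 0, of_real t * c) | a t. True}" unfolding V c(2) by blast
      then have "\<exists>c. c \<noteq> 0 \<and> V = {(a, 0, of_real t * c) | a t. True}" using c(1) by (intro exI conjI)
      then show ?thesis by (simp only: simp_thms)
    next
      assume "S = UNIV"
      then have "V = {(a, 0, c) | a c. True}" using V by simp
      then show ?thesis by (simp only: simp_thms)
    qed simp
  qed
qed

text \<open>The action is irreducible. From any nonzero triple some (0, 0, h) with h nonzero is
  reached, from this Z0 and its conjugate by suitable u and w, and from Z0 every (0, 0, c).\<close>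

lemma multialg_UNIV_cases:
  assumes "multialg UNIV V"
  shows "V = {0} \<or> V = UNIV"
proof (cases "V = {0}")
  case False
  note M = multialgD[OF assms]
  have act: "(2 * Re (u * cnj g), 2 * Re (w * g), u * of_real b + cnj w * of_real a) \<in> V"
    if "(a, b, g) \<in> V" for a b g u w
    using M(10)[OF UNIV_I that, of "(0, u, w)"] by simp
  obtain a b g where x: "(a, b, g) \<in> V" "(a, b, g) \<noteq> 0" using False M(2) by auto
  obtain h where h: "(0, 0, h) \<in> V" "h \<noteq> 0"
  proof (cases "g = 0")
    case True
    have "(0, 0, of_real b * of_real b + of_real a * of_real a) \<in> V"
      using act[OF x(1), of "of_real b" "of_real a"] True by simp
    moreover have "complex_of_real b * of_real b + of_real a * of_real a \<noteq> 0"
      using x(2) True sum_squares_eq_zero_iff[of b a]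
      by (simp add: zero_prod_def flip: of_real_mult of_real_add) blast
    ultimately show ?thesis by (rule that)
  next
    case False
    define k where "k = of_real b / cnj g"
    have k: "(2, 0, k) \<in> V"
      using act[OF x(1), of "1 / cnj g" 0] False by (simp add: k_def)
    show ?thesis
    proof (cases "k = 0")
      case True
      have "(0, 0, 2) \<in> V" using act[OF k, of 0 1] True by simp
      then show ?thesis by (rule that) simp
    next
      case False
      \<comment> \<open>With w = i/k the product w k is imaginary, so the second coordinate of the
        image vanishes.\<close>
      have "(0, 0, cnj (\<i> / k) * 2) \<in> V" using act[OF k, of 0 "\<i> / k"] False by simp
      then show ?thesis by (rule that) (simp add: False)
    qed
  qed
  have e1: "(1, 0, 0) \<in> V"
    using M(4)[OF act[OF h(1), of "1 / cnj h" 0], of "1/2"] h(2) by simp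
  have e2: "(0, 1, 0) \<in> V"
    using M(4)[OF act[OF h(1), of 0 "1 / h"], of "1/2"] h(2) by simp
  have e3: "(0, 0, c) \<in> V" for c
    using act[OF e1, of 0 "cnj c"] by simp
  have "(a, b, c) \<in> V" for a b c
    using M(3)[OF M(3)[OF M(4)[OF e1, of a] M(4)[OF e2, of b]] e3[of c]] by simp
  then show ?thesis by auto
qed simp

section \<open>Invariants of the normal forms\<close>

text \<open>Same order as \<open>normal_forms\<close>, but by equations instead of spans, so that
  closure and the invariants become arithmetic in the coordinates.\<close>

definition coord_forms :: "((complex \<times> complex \<times> complex) set \<times> (real \<times> real \<times> complex) set) list" where
  "coord_forms =
   [({(y, u, w). y = 0 \<and> u = 0 \<and> w = 0}, {(a, b, g). a = 0 \<and> b = 0 \<and> g = 0}),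
    ({(y, u, w). y = 0 \<and> u = 0 \<and> w = 0}, {(a, b, g). b = 0 \<and> g = 0}),
    ({(y, u, w). u = 0 \<and> w = 0}, {(a, b, g). a = 0 \<and> b = 0 \<and> g = 0}),
    ({(y, u, w). u = 0 \<and> w = 0}, {(a, b, g). a = b \<and> g = 0}),
    ({(y, u, w). u = 0 \<and> w = 0}, {(a, b, g). a = 0 \<and> b = 0 \<and> Re g = 0}),
    ({(y, u, w). u = 0 \<and> w = 0}, {(a, b, g). a = - b \<and> g = 0}),
    ({(y, u, w). u = 0 \<and> w = 0}, {(a, b, g). b = 0 \<and> g = 0}),
    ({(y, u, w). u = 0 \<and> w = 0}, {(a, b, g). g = 0}),
    ({(y, u, w). u = 0 \<and> w = 0}, {(a, b, g). a = 0 \<and> b = 0}),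
    ({(y, u, w). u = y \<and> w = y}, {(a, b, g). a = 0 \<and> b = 0 \<and> g = 0}),
    ({(y, u, w). u = y \<and> w = y}, {(a, b, g). a = b \<and> g = of_real b}),
    ({(y, u, w). y = 0 \<and> w = 0}, {(a, b, g). a = 0 \<and> b = 0 \<and> g = 0}),
    ({(y, u, w). y = 0 \<and> w = 0}, {(a, b, g). b = 0 \<and> g = 0}),
    ({(y, u, w). u = w}, {(a, b, g). a = 0 \<and> b = 0 \<and> g = 0}),
    ({(y, u, w). u = w}, {(a, b, g). a = b \<and> g = of_real b}),
    ({(y, u, w). u = w}, {(a, b, g). a = b \<and> Im g = 0}),
    ({(y, u, w). u = w}, {(a, b, g). a = - b \<and> Re g = 0}),
    ({(y, u, w). w = 0}, {(a, b, g). a = 0 \<and> b = 0 \<and> g = 0}),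
    ({(y, u, w). w = 0}, {(a, b, g). b = 0 \<and> g = 0}),
    ({(y, u, w). w = 0}, {(a, b, g). b = 0 \<and> Re g = 0}),
    ({(y, u, w). w = 0}, {(a, b, g). b = 0}),
    ({(y, u, w). True}, {(a, b, g). a = 0 \<and> b = 0 \<and> g = 0}),
    ({(y, u, w). True}, {(a, b, g). True})]"

lemma length_coord_forms: "length coord_forms = 23"
  by (simp add: coord_forms_def)

lemma multialgI:
  assumes "Q 0 0 0" "\<And>a b g a' b' g'. Q a b g \<Longrightarrow> Q a' b' g' \<Longrightarrow> Q (a + a') (b + b') (g + g')"
    "\<And>r a b g. Q a b g \<Longrightarrow> Q (r * a) (r * b) (of_real r * g)"
    "P 0 0 0" "\<And>y u w y' u' w'. P y u w \<Longrightarrow> P y' u' w' \<Longrightarrow> P (y + y') (u + u') (w + w')"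
    "\<And>c y u w. P y u w \<Longrightarrow> P (c * y) (c * u) (c * w)"
    "\<And>a b g a' b' g'. Q a b g \<Longrightarrow> Q a' b' g' \<Longrightarrow>
       P (of_real (a * b' + a' * b) + g * cnj g' + g' * cnj g) (2 * (of_real a * g' + of_real a' * g))
         (2 * (of_real b * cnj g' + of_real b' * cnj g))"
    "\<And>y u w y' u' w'. P y u w \<Longrightarrow> P y' u' w' \<Longrightarrow>
       P (2 * y * y' + u * w' + u' * w) (2 * (y * u' + y' * u)) (2 * (y * w' + y' * w))"
    "\<And>y u w a b g. P y u w \<Longrightarrow> Q a b g \<Longrightarrow>
       Q (2 * Re y * a + 2 * Re (u * cnj g)) (2 * Re y * b + 2 * Re (w * g))
         (2 * of_real (Re y) * g + u * of_real b + cnj w * of_real a)"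
  shows "multialg {(y, u, w). P y u w} {(a, b, g). Q a b g}"
  unfolding multialg_def subspace_def zero_prod_def
  using assms
  by (simp add: split_paired_all zero_prod_def scaleR_conv_of_real split_paired_Ball_Sigma Ball_def)

lemma multialg_coord_forms: "list_all (\<lambda>(W, V). multialg W V) coord_forms"
  unfolding coord_forms_def list.pred_inject(2) prod.case
  by (intro conjI list.pred_inject(1); rule multialgI; (elim conjE)?;
      (simp; fail | simp add: complex_eq_iff; fail | simp add: complex_eq_iff algebra_simps))

text \<open>The codes 0 to 6 number the seven W in the order of the list. A nonzero Y with vanishing
  trace and determinant is nilpotent; its presence separates W_0 from W_D and the line of z0 z0^T
  from that of e1 e1^T.\<close>

definition wtype :: "(complex^2^2) set \<Rightarrow> nat" where
  "wtype W =
     (if \<exists>Y\<in>W. Y \<noteq> 0 \<and> trace Y = 0 \<and> det Y = 0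
      then if \<exists>Y\<in>W. trace Y = 0 \<and> det Y \<noteq> 0 then 6 else if \<exists>Y\<in>W. det Y \<noteq> 0 then 5 else 3
      else if \<exists>Y\<in>W. trace Y = 0 \<and> det Y \<noteq> 0 then 4 else if \<exists>Y\<in>W. det Y \<noteq> 0 then 1
      else if \<exists>Y\<in>W. trace Y \<noteq> 0 then 2 else 0)"

text \<open>The condition with the square says that the quadratic form \<open>det\<close> has rank at least two
  on \<open>V\<close>; it replaces a comparison of dimensions.\<close>

definition vtype :: "(complex^2^2) set \<Rightarrow> nat" where
  "vtype V =
     (if \<exists>X\<in>V. Re (det X) > 0 then if \<exists>X\<in>V. Re (det X) < 0 then 1 else 2
      else if \<exists>X\<in>V. Re (det X) < 0
      then if \<exists>X\<in>V. Re (trace (X ** cnjm X)) < 0 then 3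
        else if \<exists>X\<in>V. \<exists>X'\<in>V. (det (X + X') - det X - det X')\<^sup>2 \<noteq> 4 * det X * det X' then 4 else 5
      else if \<exists>X\<in>V. X \<noteq> 0 then 6 else 0)"

section \<open>Invariance of the types under equivalence\<close>

lemma O2C_det: "C \<in> O2C \<Longrightarrow> det C * det C = 1"
  unfolding O2C_def by (metis (mono_tags, lifting) det_I det_mul det_transpose mem_Collect_eq)

lemma det_cnjm: "det (cnjm C) = cnj (det C)"
  by (simp add: det_2)

lemma hact_inj: "C \<in> O2C \<Longrightarrow> s \<in> {1, -1} \<Longrightarrow> hact C s X = 0 \<longleftrightarrow> X = 0"
  and sact_inj: "C \<in> O2C \<Longrightarrow> sact C Y = 0 \<longleftrightarrow> Y = 0"
proof -
  have id: "ctranspose (mat 1) = mat 1"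
    by (simp add: mat_entries mat_def)
  have z: "hact C s 0 = 0" "sact C 0 = 0" for C s
    by (simp_all add: hact_def sact_def)
  show "hact C s X = 0 \<longleftrightarrow> X = 0" if C: "C \<in> O2C" "s \<in> {1, -1}"
  proof
    assume "hact C s X = 0"
    then have "hact (transpose C) s (hact C s X) = 0" by (simp add: z)
    moreover have "hact (transpose C) s (hact C s X) = X"
      using O2C_transpose[OF C(1)] C(2) by (auto simp: hact_compose) (simp_all add: hact_def id)
    ultimately show "X = 0" by simp
  qed (simp add: z)
  show "sact C Y = 0 \<longleftrightarrow> Y = 0" if C: "C \<in> O2C"
  proof
    assume "sact C Y = 0"
    then have "sact (transpose C) (sact C Y) = 0" by (simp add: z)
    moreover have "sact (transpose C) (sact C Y) = Y"
      using O2C_transpose[OF C(1)] by (simp add: sact_compose) (simp add: sact_def transpose_mat)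
    ultimately show "Y = 0" by simp
  qed (simp add: z)
qed

lemma det_sact: "C \<in> O2C \<Longrightarrow> det (sact C Y) = det Y"
  using O2C_det[of C] by (simp add: sact_def det_mul det_transpose)

lemma trace_sact: "C \<in> O2C \<Longrightarrow> trace (sact C Y) = trace Y"
  unfolding sact_def by (metis O2C_transpose matrix_mul_assoc matrix_mul_lid trace_mul_sym)

text \<open>det C is 1 or -1, hence real, so C and its conjugate transpose contribute 1 together; s
  enters squared because the matrices have size two.\<close>

lemma det_hact:
  assumes "C \<in> O2C" "s \<in> {1, -1}"
  shows "det (hact C s X) = det X"
proof -
  have "det (ctranspose C) = cnj (det C)"
    by (simp add: ctranspose_def det_transpose det_cnjm)
  moreover have "det C * cnj (det C) = 1"
    using O2C_det[OF assms(1)] by (auto simp: square_eq_1_iff)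
  moreover have "det (s *\<^sub>R M) = det M" for M :: "complex^2^2"
    using assms(2) by (auto simp: det_2)
  ultimately show ?thesis
    by (simp add: hact_def det_mul)
qed

text \<open>The inner factor collapses, since C^H cnj C is the conjugate of C^T C = I, and the two
  signs cancel. So the trace of X cnj X is an invariant although the trace of X is not.\<close>

lemma hact_cnjm:
  assumes "C \<in> O2C" "s \<in> {1, -1}"
  shows "hact C s X ** cnjm (hact C s X) = sact C (X ** cnjm X)"
proof -
  have c: "cnjm (A ** B) = cnjm A ** cnjm B" for A B :: "complex^2^2"
    by (simp add: mat_entries)
  have "ctranspose C ** cnjm C = cnjm (transpose C ** C)"
    by (simp add: mat_entries)
  also have "\<dots> = mat 1"
    using O2C_transpose[OF assms(1)] by (simp add: mat_entries mat_def)
  finally have 1: "ctranspose C ** cnjm C = mat 1" .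
  have 2: "cnjm (ctranspose C) = transpose C"
    by (simp add: mat_entries)
  have "hact C s X ** cnjm (hact C s X) = (C ** X ** ctranspose C) ** cnjm (C ** X ** ctranspose C)"
    using assms(2) by (auto simp: hact_def mat_entries)
  also have "\<dots> = C ** X ** (ctranspose C ** cnjm C) ** cnjm X ** transpose C"
    by (simp add: c 2 matrix_mul_assoc)
  also have "\<dots> = sact C (X ** cnjm X)"
    by (simp add: 1 sact_def matrix_mul_assoc)
  finally show ?thesis .
qed

lemma hact_add: "hact C s (X + X') = hact C s X + hact C s X'"
  by (simp add: hact_def mat_entries algebra_simps)

lemma vtype_hact: "C \<in> O2C \<Longrightarrow> s \<in> {1, -1} \<Longrightarrow> vtype (hact C s ` V) = vtype V"
  by (simp only: vtype_def bex_simps det_hact hact_inj hact_cnjm trace_sact hact_add[symmetric])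

lemma wtype_sact: "C \<in> O2C \<Longrightarrow> wtype (sact C ` W) = wtype W"
  by (simp only: wtype_def bex_simps det_sact sact_inj trace_sact)

text \<open>Because zero lies in all four sets, each factor is recovered as a slice of the set of
  operators, and an equivalence of the operator sets splits into one of W and one of V.\<close>

lemma equivalent_types:
  assumes E: "equivalent_ops (ops_of (W, V)) (ops_of (W', V'))"
    and 0: "0 \<in> W" "0 \<in> V" "0 \<in> W'" "0 \<in> V'"
  shows "wtype W = wtype W' \<and> vtype V = vtype V'"
proof -
  obtain C s where C: "C \<in> O2C" "s \<in> {1, -1}" "ops_of (W', V') = opact C s (ops_of (W, V))"
    using E unfolding equivalent_ops_iff by blast
  have mem: "K X Y \<in> ops_of (W, V) \<longleftrightarrow> X \<in> V \<and> Y \<in> W" for X Y W V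
    unfolding ops_of_def by (auto simp: K_inject)
  have "W' = {Y. K 0 Y \<in> ops_of (W', V')}" using 0 by (simp add: mem)
  also have "\<dots> = sact C ` W"
    unfolding C(3) opact_def using 0 hact_inj[OF C(1,2)] by (auto simp: K_inject mem)
  finally have W: "W' = sact C ` W" .
  have "V' = {X. K X 0 \<in> ops_of (W', V')}" using 0 by (simp add: mem)
  also have "\<dots> = hact C s ` V"
    unfolding C(3) opact_def using 0 sact_inj[OF C(1)] by (auto simp: K_inject mem)
  finally have V: "V' = hact C s ` V" .
  show ?thesis
    unfolding V W using C by (simp add: vtype_hact wtype_sact)
qed

section \<open>The types in coordinates\<close>

lemma det_xmat: "det (xmat (a, b, g)) = of_real (4 * (a * b - (cmod g)\<^sup>2))"
  unfolding cmod_power2 by (simp add: det_2 xmat.simps complex_eq_iff power2_eq_square algebra_simps)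

lemma det_ymat: "det (ymat (y, u, w)) = 4 * (y * y - u * w)"
  by (simp add: det_2 ymat.simps complex_eq_iff algebra_simps)

lemma trace_ymat: "trace (ymat (y, u, w)) = 4 * y"
  by (simp add: trace_def sum_2 ymat.simps)

lemma trace_xmat_cnjm: "trace (xmat (a, b, g) ** cnjm (xmat (a, b, g))) = of_real (8 * (a * b + (cmod g)\<^sup>2))"
  unfolding cmod_power2
  by (simp add: trace_def sum_2 mat_mult_nth xmat.simps complex_eq_iff power2_eq_square algebra_simps)

lemma xmat_eq_0: "xmat (a, b, g) = 0 \<longleftrightarrow> a = 0 \<and> b = 0 \<and> g = 0"
  by (auto simp: mat2_eq_iff xmat.simps complex_eq_iff)

lemma ymat_eq_0: "ymat (y, u, w) = 0 \<longleftrightarrow> y = 0 \<and> u = 0 \<and> w = 0"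
  by (auto simp: mat2_eq_iff ymat.simps complex_eq_iff)

lemma wtype_ymat:
  "wtype (ymat ` {(y, u, w). P y u w}) =
     (if \<exists>u w. P 0 u w \<and> (u \<noteq> 0 \<or> w \<noteq> 0) \<and> u * w = 0
      then if \<exists>u w. P 0 u w \<and> u * w \<noteq> 0 then 6 else if \<exists>y u w. P y u w \<and> y * y \<noteq> u * w then 5 else 3
      else if \<exists>u w. P 0 u w \<and> u * w \<noteq> 0 then 4 else if \<exists>y u w. P y u w \<and> y * y \<noteq> u * w then 1
      else if \<exists>y u w. P y u w \<and> y \<noteq> 0 then 2 else 0)"
proof -
  have ex: "(\<exists>Y\<in>ymat ` {(y, u, w). P y u w}. R Y) \<longleftrightarrow> (\<exists>y u w. P y u w \<and> R (ymat (y, u, w)))" for R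
    by auto
  have 1: "(\<exists>y u w. P y u w \<and> \<not> (y = 0 \<and> u = 0 \<and> w = 0) \<and> 4 * y = 0 \<and> 4 * (y * y - u * w) = 0)
      \<longleftrightarrow> (\<exists>u w. P 0 u w \<and> (u \<noteq> 0 \<or> w \<noteq> 0) \<and> u * w = 0)"
    by auto
  have 2: "(\<exists>y u w. P y u w \<and> 4 * y = 0 \<and> 4 * (y * y - u * w) \<noteq> 0) \<longleftrightarrow> (\<exists>u w. P 0 u w \<and> u * w \<noteq> 0)"
    by auto
  have 3: "(\<exists>y u w. P y u w \<and> 4 * (y * y - u * w) \<noteq> 0) \<longleftrightarrow> (\<exists>y u w. P y u w \<and> y * y \<noteq> u * w)"
    by auto
  have 4: "(\<exists>y u w. P y u w \<and> 4 * y \<noteq> 0) \<longleftrightarrow> (\<exists>y u w. P y u w \<and> y \<noteq> 0)"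
    by auto
  show ?thesis
    unfolding wtype_def ex det_ymat trace_ymat ymat_eq_0 1 2 3 4 by (rule refl)
qed

lemma ex_xmat: "(\<exists>X\<in>xmat ` {(a, b, g). Q a b g}. R X) \<longleftrightarrow> (\<exists>a b g. Q a b g \<and> R (xmat (a, b, g)))"
  by auto

text \<open>On Hermitian matrices det is 4(ab - |g|^2), a real form of Lorentzian signature with
  null coordinates a and b. The trace of X cnj X is 8(ab + |g|^2), so it is negative only where ab
  is negative and dominates |g|^2.\<close>

lemma vtype_xmat:
  "vtype (xmat ` {(a, b, g). Q a b g}) =
     (if \<exists>a b g. Q a b g \<and> a * b > (cmod g)\<^sup>2
      then if \<exists>a b g. Q a b g \<and> a * b < (cmod g)\<^sup>2 then 1 else 2
      else if \<exists>a b g. Q a b g \<and> a * b < (cmod g)\<^sup>2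
      then if \<exists>a b g. Q a b g \<and> a * b + (cmod g)\<^sup>2 < 0 then 3
        else if \<exists>a b g a' b' g'. Q a b g \<and> Q a' b' g' \<and>
          (a * b' + a' * b - 2 * Re (g * cnj g'))\<^sup>2 \<noteq> 4 * (a * b - (cmod g)\<^sup>2) * (a' * b' - (cmod g')\<^sup>2) then 4 else 5
      else if \<exists>a b g. Q a b g \<and> (a \<noteq> 0 \<or> b \<noteq> 0 \<or> g \<noteq> 0) then 6 else 0)"
proof -
  have polar: "(det (xmat (a, b, g) + xmat (a', b', g')) - det (xmat (a, b, g)) - det (xmat (a', b', g')))\<^sup>2
        \<noteq> 4 * det (xmat (a, b, g)) * det (xmat (a', b', g'))
      \<longleftrightarrow> (a * b' + a' * b - 2 * Re (g * cnj g'))\<^sup>2 \<noteq> 4 * (a * b - (cmod g)\<^sup>2) * (a' * b' - (cmod g')\<^sup>2)"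
    for a b g a' b' g'
  proof -
    have s: "xmat (a, b, g) + xmat (a', b', g') = xmat (a + a', b + b', g + g')"
      by (simp flip: xmat_add)
    have d: "det (xmat (a, b, g) + xmat (a', b', g')) - det (xmat (a, b, g)) - det (xmat (a', b', g'))
        = of_real (4 * (a * b' + a' * b - 2 * Re (g * cnj g')))"
      unfolding s det_xmat cmod_power2 of_real_diff[symmetric]
      by (intro arg_cong[of _ _ complex_of_real]) (simp add: power2_eq_square algebra_simps)
    have "(of_real (4 * r) :: complex)\<^sup>2 \<noteq> 4 * of_real (4 * p) * of_real (4 * q) \<longleftrightarrow> r\<^sup>2 \<noteq> 4 * p * q" for r p q
    proof -
      have "(of_real (4 * r) :: complex)\<^sup>2 = of_real (16 * r\<^sup>2)"
        "4 * of_real (4 * p) * of_real (4 * q) = (of_real (16 * (4 * p * q)) :: complex)"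
        by (simp_all add: power_mult_distrib)
      then show ?thesis unfolding of_real_eq_iff by (simp del: of_real_mult add: mult.assoc)
    qed
    then show ?thesis unfolding d unfolding det_xmat .
  qed
  have neg: "Re (of_real (4 * (a * b - (cmod g)\<^sup>2))) < 0 \<longleftrightarrow> a * b < (cmod g)\<^sup>2"
    and pos: "Re (of_real (4 * (a * b - (cmod g)\<^sup>2))) > 0 \<longleftrightarrow> a * b > (cmod g)\<^sup>2"
    and tr: "Re (of_real (8 * (a * b + (cmod g)\<^sup>2))) < 0 \<longleftrightarrow> a * b + (cmod g)\<^sup>2 < 0" for a b g
    unfolding Re_complex_of_real by auto
  show ?thesis
    unfolding vtype_def ex_xmat polar unfolding det_xmat trace_xmat_cnjm xmat_eq_0 pos neg tr
    by (simp only: ex_simps de_Morgan_conj)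
qed

lemma wtype_values:
  "wtype (ymat ` {(y, u, w). y = 0 \<and> u = 0 \<and> w = 0}) = 0"
  "wtype (ymat ` {(y, u, w). u = 0 \<and> w = 0}) = 1"
  "wtype (ymat ` {(y, u, w). u = y \<and> w = y}) = 2"
  "wtype (ymat ` {(y, u, w). y = 0 \<and> w = 0}) = 3"
  "wtype (ymat ` {(y, u, w). u = w}) = 4"
  "wtype (ymat ` {(y, u, w). w = 0}) = 5"
  "wtype (ymat ` {(y, u, w). True}) = 6"
  unfolding wtype_ymat by (auto intro: exI[of _ 1] exI[of _ "\<lambda>x. x"])

lemma vtype_values:
  "vtype (xmat ` {(a, b, g). a = 0 \<and> b = 0 \<and> g = 0}) = 0"
  "vtype (xmat ` {(a, b, g). b = 0 \<and> g = 0}) = 6"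
  "vtype (xmat ` {(a, b, g). a = b \<and> g = of_real b}) = 6"
  unfolding vtype_xmat by (auto intro: exI[of _ 1] simp: power2_eq_square)

text \<open>Here det is indefinite: it is positive at 2I, the triple (1, 1, 0), and negative at the
  difference of Z0 and its conjugate, the triple (1, -1, 0), or at diag(2, -2), the triple (0, 0,
  1).\<close>

lemma vtype_1:
  "vtype (xmat ` {(a, b, g). g = 0}) = 1"
  "vtype (xmat ` {(a, b, g). a = b \<and> Im g = 0}) = 1"
  "vtype (xmat ` {(a, b, g). True}) = 1"
proof -
  have 1: "\<exists>a b g. Q a b g \<and> a * b > (cmod g)\<^sup>2" if "Q 1 1 0" for Q
    using that by (intro exI[of _ 1] exI[of _ 0]) simp
  have 2: "\<exists>a b g. Q a b g \<and> a * b < (cmod g)\<^sup>2" if "Q 1 (-1) 0" for Q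
    using that by (intro exI[of _ 1] exI[of _ "-1"] exI[of _ 0]) simp
  have 3: "\<exists>a b g. Q a b g \<and> a * b < (cmod g)\<^sup>2" if "Q 0 0 1" for Q
    using that by (intro exI[of _ 0] exI[of _ 1]) simp
  show "vtype (xmat ` {(a, b, g). g = 0}) = 1"
    unfolding vtype_xmat by (subst if_P, rule 1, simp, subst if_P, rule 2, simp, simp)
  show "vtype (xmat ` {(a, b, g). a = b \<and> Im g = 0}) = 1" "vtype (xmat ` {(a, b, g). True}) = 1"
    unfolding vtype_xmat by (subst if_P, rule 1, simp, subst if_P, rule 3, simp, simp)+
qed

lemma vtype_2: "vtype (xmat ` {(a, b, g). a = b \<and> g = 0}) = 2"
  unfolding vtype_xmat by (auto intro: exI[of _ 1] simp: not_less)

text \<open>With a = -b, det is nowhere positive. The triple (-1, 1, 0) is X = 2i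
  \<open>Rperp\<close>, for which X cnj X = -4I has negative trace.\<close>

lemma vtype_3:
  "vtype (xmat ` {(a, b, g). a = - b \<and> g = 0}) = 3"
  "vtype (xmat ` {(a, b, g). a = - b \<and> Re g = 0}) = 3"
proof -
  have n: "\<not> - (b * b) > (cmod g)\<^sup>2" for b g
    unfolding not_less by (rule order_trans[of _ 0]) simp_all
  have 2: "\<exists>a b g. Q a b g \<and> a * b < (cmod g)\<^sup>2" and 3: "\<exists>a b g. Q a b g \<and> a * b + (cmod g)\<^sup>2 < 0"
    if "Q (-1) 1 0" for Q
    using that by (intro exI[of _ "-1"] exI[of _ 1] exI[of _ 0]; simp)+
  show "vtype (xmat ` {(a, b, g). a = - b \<and> g = 0}) = 3" "vtype (xmat ` {(a, b, g). a = - b \<and> Re g = 0}) = 3"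
    unfolding vtype_xmat
    by (subst if_not_P, use n in force, subst if_P, rule 2, simp, subst if_P, rule 3, simp, simp)+
qed

text \<open>On the plane a = b = 0, det is -4|g|^2, which is negative definite; g = 1 and g = i
  witness rank two.\<close>

lemma vtype_4:
  "vtype (xmat ` {(a, b, g). a = 0 \<and> b = 0}) = 4"
  "vtype (xmat ` {(a, b, g). b = 0}) = 4"
proof -
  have 1: "\<exists>a b g. Q a b g \<and> a * b < (cmod g)\<^sup>2" if "Q 0 0 1" for Q
    using that by (intro exI[of _ 0] exI[of _ 1]) simp
  have 2: "\<exists>a b g a' b' g'. Q a b g \<and> Q a' b' g' \<and>
      (a * b' + a' * b - 2 * Re (g * cnj g'))\<^sup>2 \<noteq> 4 * (a * b - (cmod g)\<^sup>2) * (a' * b' - (cmod g')\<^sup>2)"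
    if "Q 0 0 1" "Q 0 0 \<i>" for Q
    using that by (intro exI[of _ 0] exI[of _ 1] exI[of _ \<i>]) simp
  show "vtype (xmat ` {(a, b, g). a = 0 \<and> b = 0}) = 4" "vtype (xmat ` {(a, b, g). b = 0}) = 4"
    unfolding vtype_xmat
    by (subst if_not_P, force, subst if_P, rule 1, simp, subst if_not_P, simp add: not_less, subst if_P, rule 2, simp, simp, simp)+
qed

text \<open>On both spaces det is -4 (Im g)^2, minus the square of one linear form, so the
  discriminant condition holds with equality, while the trace of X cnj X is nonnegative.\<close>

lemma vtype_5:
  "vtype (xmat ` {(a, b, g). a = 0 \<and> b = 0 \<and> Re g = 0}) = 5"
  "vtype (xmat ` {(a, b, g). b = 0 \<and> Re g = 0}) = 5"
proof -
  have 1: "\<exists>a b g. Q a b g \<and> a * b < (cmod g)\<^sup>2" if "Q 0 0 \<i>" for Q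
    using that by (intro exI[of _ 0] exI[of _ \<i>]) simp
  show "vtype (xmat ` {(a, b, g). a = 0 \<and> b = 0 \<and> Re g = 0}) = 5"
    unfolding vtype_xmat
    by (subst if_not_P, force, subst if_P, rule 1, simp, subst if_not_P, simp add: not_less, subst if_not_P,
        auto simp: cmod_power2 power_mult_distrib)
  show "vtype (xmat ` {(a, b, g). b = 0 \<and> Re g = 0}) = 5"
    unfolding vtype_xmat
    by (subst if_not_P, force, subst if_P, rule 1, simp, subst if_not_P, simp add: not_less, subst if_not_P,
        auto simp: cmod_power2 power_mult_distrib)
qed

section \<open>Reduction to normal form\<close>

lemma image_eq_inverseI:
  assumes "\<And>x. x \<in> A \<Longrightarrow> f x \<in> B" "\<And>z. z \<in> B \<Longrightarrow> g z \<in> A \<and> f (g z) = z"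
  shows "f ` A = B"
  using assms by force

lemma cspan_pair: "cmat.span {X, X'} = {cscale k X + cscale l X' | k l. True}"
  unfolding cmat.span_insert[of X] cmat.span_singleton
  by (auto simp: image_iff algebra_simps)

lemma span_pair: "span {X, X'} = {k *\<^sub>R X + l *\<^sub>R X' | k l. True}" for X X' :: "complex^2^2"
  unfolding span_insert[of X] span_singleton
  by (auto simp: image_iff algebra_simps)

lemma matrices_nth:
  "mat 1 $ (1::2) $ (1::2) = (1::complex)" "mat 1 $ (1::2) $ (2::2) = (0::complex)" "mat 1 $ (2::2) $ (1::2) = (0::complex)" "mat 1 $ (2::2) $ (2::2) = (1::complex)"
  "outer e1 e1 = mat2 1 0 0 0" "outer e2 e2 = mat2 0 0 0 1" "outer z0 z0 = mat2 1 (- \<i>) (- \<i>) (-1)"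
  by (simp_all add: mat_def mat2_eq_iff outer_def e1_def e2_def axis_def z0_def)

section \<open>The spaces of the list as images of coordinate sets\<close>

lemma ymat_images:
  "ymat ` {(y, u, w). y = 0 \<and> u = 0 \<and> w = 0} = {0}"
  "ymat ` {(y, u, w). u = 0 \<and> w = 0} = cmat.span {mat 1}"
  "ymat ` {(y, u, w). u = y \<and> w = y} = cmat.span {outer e1 e1}"
  "ymat ` {(y, u, w). y = 0 \<and> w = 0} = cmat.span {outer z0 z0}"
  "ymat ` {(y, u, w). u = w} = W_D"
  "ymat ` {(y, u, w). w = 0} = W_0"
  "ymat ` {(y, u, w). True} = symmetric_mats"
proof -
  have "{(y, u, w). y = 0 \<and> u = 0 \<and> w = 0} = {0 :: complex \<times> complex \<times> complex}"
    by (auto simp: zero_prod_def)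
  then show "ymat ` {(y, u, w). y = 0 \<and> u = 0 \<and> w = 0} = {0}"
    by (simp add: ymat_0)
  show "ymat ` {(y, u, w). u = 0 \<and> w = 0} = cmat.span {mat 1}"
    unfolding cmat.span_singleton
  proof (rule image_eq_inverseI[where g = "\<lambda>M. (M$1$1 / 2, 0, 0)"])
    fix x :: "complex \<times> complex \<times> complex" assume "x \<in> {(y, u, w). u = 0 \<and> w = 0}"
    then obtain y where "x = (y, 0, 0)" by auto
    then have "ymat x = cscale (2 * y) (mat 1)" by (simp add: ymat.simps mat2_eq_iff cscale_nth matrices_nth)
    then show "ymat x \<in> range (\<lambda>k. cscale k (mat 1))" by blast
  qed (auto simp: ymat.simps mat2_eq_iff cscale_nth matrices_nth)
  show "ymat ` {(y, u, w). u = y \<and> w = y} = cmat.span {outer e1 e1}"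
    unfolding cmat.span_singleton
  proof (rule image_eq_inverseI[where g = "\<lambda>M. (M$1$1 / 4, M$1$1 / 4, M$1$1 / 4)"])
    fix x :: "complex \<times> complex \<times> complex" assume "x \<in> {(y, u, w). u = y \<and> w = y}"
    then obtain y where "x = (y, y, y)" by auto
    then have "ymat x = cscale (4 * y) (outer e1 e1)" by (simp add: ymat.simps mat2_eq_iff cscale_nth matrices_nth)
    then show "ymat x \<in> range (\<lambda>k. cscale k (outer e1 e1))" by blast
  qed (auto simp: ymat.simps mat2_eq_iff cscale_nth matrices_nth)
  show "ymat ` {(y, u, w). y = 0 \<and> w = 0} = cmat.span {outer z0 z0}"
    unfolding cmat.span_singleton
  proof (rule image_eq_inverseI[where g = "\<lambda>M. (0, M$1$1, 0)"])
    fix x :: "complex \<times> complex \<times> complex" assume "x \<in> {(y, u, w). y = 0 \<and> w = 0}"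
    then obtain u where "x = (0, u, 0)" by auto
    then have "ymat x = cscale u (outer z0 z0)" by (simp add: ymat.simps mat2_eq_iff cscale_nth matrices_nth)
    then show "ymat x \<in> range (\<lambda>k. cscale k (outer z0 z0))" by blast
  qed (auto simp: ymat.simps mat2_eq_iff cscale_nth matrices_nth)
  show "ymat ` {(y, u, w). u = w} = W_D"
    unfolding W_D_def
  proof (rule image_eq_inverseI[where g = "\<lambda>M. ((M$1$1 + M$2$2) / 4, (M$1$1 - M$2$2) / 4, (M$1$1 - M$2$2) / 4)"])
    fix x :: "complex \<times> complex \<times> complex" assume "x \<in> {(y, u, w). u = w}"
    then obtain y u where "x = (y, u, u)" by auto
    then have "ymat x = mat2 (2 * y + 2 * u) 0 0 (2 * y - 2 * u)" by (simp add: ymat.simps mat2_eq_iff)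
    then show "ymat x \<in> {mat2 a 0 0 d | a d. True}" by blast
  qed (auto simp: ymat.simps mat2_eq_iff field_simps)
  show "ymat ` {(y, u, w). w = 0} = W_0"
    unfolding W_0_def cspan_pair
  proof (rule image_eq_inverseI[where g = "\<lambda>M. ((M$1$1 + M$2$2) / 4, (M$1$1 - M$2$2) / 2, 0)"])
    fix x :: "complex \<times> complex \<times> complex" assume "x \<in> {(y, u, w). w = 0}"
    then obtain y u where "x = (y, u, 0)" by auto
    then have "ymat x = cscale (2 * y) (mat 1) + cscale u (outer z0 z0)"
      by (simp add: ymat.simps mat2_eq_iff cscale_nth matrices_nth)
    then show "ymat x \<in> {cscale k (mat 1) + cscale l (outer z0 z0) | k l. True}" by blast
  qed (auto simp: ymat.simps mat2_eq_iff cscale_nth matrices_nth)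
  show "ymat ` {(y, u, w). True} = symmetric_mats"
    using range_ymat by (simp add: case_prod_unfold)
qed

lemma xmat_images:
  "xmat ` {(a, b, g). a = 0 \<and> b = 0 \<and> g = 0} = {0}"
  "xmat ` {(a, b, g). b = 0 \<and> g = 0} = span {Z0}"
  "xmat ` {(a, b, g). a = b \<and> g = 0} = span {mat 1}"
  "xmat ` {(a, b, g). a = 0 \<and> b = 0 \<and> Re g = 0} = span {psi \<i>}"
  "xmat ` {(a, b, g). a = - b \<and> g = 0} = span {cscale \<i> Rperp}"
  "xmat ` {(a, b, g). g = 0} = Phi_space"
  "xmat ` {(a, b, g). a = 0 \<and> b = 0} = Psi_space"
  "xmat ` {(a, b, g). a = b \<and> g = of_real b} = span {outer e1 e1}"
  "xmat ` {(a, b, g). a = b \<and> Im g = 0} = span {outer e1 e1, outer e2 e2}"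
  "xmat ` {(a, b, g). a = - b \<and> Re g = 0} = {mat2 0 (cnj c) c 0 | c. True}"
  "xmat ` {(a, b, g). b = 0 \<and> Re g = 0} = {mat2 (of_real y) (Complex x y) (Complex x (-y)) (of_real y) | x y. True}"
  "xmat ` {(a, b, g). b = 0} = {X \<in> hermitian_mats. trace X = of_real (2 * Im (X $ 1 $ 2))}"
  "xmat ` {(a, b, g). True} = hermitian_mats"
proof -
  have "{(a, b, g). a = 0 \<and> b = 0 \<and> g = 0} = {0 :: real \<times> real \<times> complex}"
    by (auto simp: zero_prod_def)
  then show "xmat ` {(a, b, g). a = 0 \<and> b = 0 \<and> g = 0} = {0}"
    by (simp add: xmat_0)
  show "xmat ` {(a, b, g). b = 0 \<and> g = 0} = span {Z0}"
    unfolding span_singleton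
  proof (rule image_eq_inverseI[where g = "\<lambda>M. (Re (M$1$1), 0, 0)"])
    fix x :: "real \<times> real \<times> complex" assume "x \<in> {(a, b, g). b = 0 \<and> g = 0}"
    then obtain a where "x = (a, 0, 0)" by auto
    then have "xmat x = a *\<^sub>R Z0" by (simp add: xmat.simps mat2_eq_iff Z0_eq complex_eq_iff)
    then show "xmat x \<in> range (\<lambda>k. k *\<^sub>R Z0)" by blast
  qed (auto simp: xmat.simps mat2_eq_iff Z0_eq complex_eq_iff)
  show "xmat ` {(a, b, g). a = b \<and> g = 0} = span {mat 1}"
    unfolding span_singleton
  proof (rule image_eq_inverseI[where g = "\<lambda>M. (Re (M$1$1) / 2, Re (M$1$1) / 2, 0)"])
    fix x :: "real \<times> real \<times> complex" assume "x \<in> {(a, b, g). a = b \<and> g = 0}"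
    then obtain a where "x = (a, a, 0)" by auto
    then have "xmat x = (2 * a) *\<^sub>R mat 1" by (simp add: xmat.simps mat2_eq_iff matrices_nth complex_eq_iff)
    then show "xmat x \<in> range (\<lambda>k. k *\<^sub>R mat 1)" by blast
  qed (auto simp: xmat.simps mat2_eq_iff matrices_nth complex_eq_iff)
  show "xmat ` {(a, b, g). a = 0 \<and> b = 0 \<and> Re g = 0} = span {psi \<i>}"
    unfolding span_singleton
  proof (rule image_eq_inverseI[where g = "\<lambda>M. (0, 0, \<i> * of_real (Re (M$1$2) / 2))"])
    fix x :: "real \<times> real \<times> complex" assume "x \<in> {(a, b, g). a = 0 \<and> b = 0 \<and> Re g = 0}"
    then obtain g where "x = (0, 0, g)" "Re g = 0" by auto
    then have "xmat x = (2 * Im g) *\<^sub>R psi \<i>" by (simp add: xmat.simps mat2_eq_iff psi_def complex_eq_iff)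
    then show "xmat x \<in> range (\<lambda>k. k *\<^sub>R psi \<i>)" by blast
  qed (auto simp: xmat.simps mat2_eq_iff psi_def complex_eq_iff)
  show "xmat ` {(a, b, g). a = - b \<and> g = 0} = span {cscale \<i> Rperp}"
    unfolding span_singleton
  proof (rule image_eq_inverseI[where g = "\<lambda>M. (Im (M$1$2) / 2, - (Im (M$1$2) / 2), 0)"])
    fix x :: "real \<times> real \<times> complex" assume "x \<in> {(a, b, g). a = - b \<and> g = 0}"
    then obtain b where "x = (- b, b, 0)" by auto
    then have "xmat x = (2 * b) *\<^sub>R cscale \<i> Rperp" by (simp add: xmat.simps mat2_eq_iff Rperp_def cscale_nth complex_eq_iff)
    then show "xmat x \<in> range (\<lambda>k. k *\<^sub>R cscale \<i> Rperp)" by blast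
  qed (auto simp: xmat.simps mat2_eq_iff Rperp_def cscale_nth complex_eq_iff)
  show "xmat ` {(a, b, g). g = 0} = Phi_space"
    unfolding Phi_space_def
  proof (rule image_eq_inverseI[where g = "\<lambda>M. ((Re (M$1$1) + Im (M$1$2)) / 2, (Re (M$1$1) - Im (M$1$2)) / 2, 0)"])
    fix x :: "real \<times> real \<times> complex" assume "x \<in> {(a, b, g). g = 0}"
    then obtain a b where "x = (a, b, 0)" by auto
    then have "xmat x = mat2 (of_real (a + b)) (\<i> * of_real (a - b)) (- \<i> * of_real (a - b)) (of_real (a + b))"
      by (simp add: xmat.simps mat2_eq_iff complex_eq_iff)
    then show "xmat x \<in> {mat2 (of_real \<alpha>) (\<i> * of_real \<beta>) (- \<i> * of_real \<beta>) (of_real \<alpha>) | \<alpha> \<beta>. True}" by blast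
  qed (auto simp: xmat.simps mat2_eq_iff complex_eq_iff field_simps)
  show "xmat ` {(a, b, g). a = 0 \<and> b = 0} = Psi_space"
    unfolding Psi_space_def
  proof (rule image_eq_inverseI[where g = "\<lambda>M. (0, 0, Complex (Re (M$1$1) / 2) (Re (M$1$2) / 2))"])
    fix x :: "real \<times> real \<times> complex" assume "x \<in> {(a, b, g). a = 0 \<and> b = 0}"
    then obtain g where "x = (0, 0, g)" by auto
    then have "xmat x = psi (2 * g)" by (simp add: xmat.simps mat2_eq_iff psi_def complex_eq_iff)
    then show "xmat x \<in> range psi" by blast
  qed (auto simp: xmat.simps mat2_eq_iff psi_def complex_eq_iff)
  show "xmat ` {(a, b, g). a = b \<and> g = of_real b} = span {outer e1 e1}"
    unfolding span_singleton
  proof (rule image_eq_inverseI[where g = "\<lambda>M. (Re (M$1$1) / 4, Re (M$1$1) / 4, of_real (Re (M$1$1) / 4))"])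
    fix x :: "real \<times> real \<times> complex" assume "x \<in> {(a, b, g). a = b \<and> g = of_real b}"
    then obtain a where "x = (a, a, of_real a)" by auto
    then have "xmat x = (4 * a) *\<^sub>R outer e1 e1" by (simp add: xmat.simps mat2_eq_iff matrices_nth complex_eq_iff)
    then show "xmat x \<in> range (\<lambda>k. k *\<^sub>R outer e1 e1)" by blast
  qed (auto simp: xmat.simps mat2_eq_iff matrices_nth complex_eq_iff)
  show "xmat ` {(a, b, g). a = b \<and> Im g = 0} = span {outer e1 e1, outer e2 e2}"
    unfolding span_pair
  proof (rule image_eq_inverseI[where g = "\<lambda>M. (Re (M$1$1 + M$2$2) / 4, Re (M$1$1 + M$2$2) / 4, of_real (Re (M$1$1 - M$2$2) / 4))"])
    fix x :: "real \<times> real \<times> complex" assume "x \<in> {(a, b, g). a = b \<and> Im g = 0}"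
    then obtain a g where "x = (a, a, g)" "Im g = 0" by auto
    then have "xmat x = (2 * a + 2 * Re g) *\<^sub>R outer e1 e1 + (2 * a - 2 * Re g) *\<^sub>R outer e2 e2"
      by (simp add: xmat.simps mat2_eq_iff matrices_nth complex_eq_iff)
    then show "xmat x \<in> {k *\<^sub>R outer e1 e1 + l *\<^sub>R outer e2 e2 | k l. True}" by blast
  qed (auto simp: xmat.simps mat2_eq_iff matrices_nth complex_eq_iff field_simps)
  show "xmat ` {(a, b, g). a = - b \<and> Re g = 0} = {mat2 0 (cnj c) c 0 | c. True}"
  proof (rule image_eq_inverseI[where g = "\<lambda>M. (- (Im (M$2$1) / 2), Im (M$2$1) / 2, \<i> * of_real (Re (M$2$1) / 2))"])
    fix x :: "real \<times> real \<times> complex" assume "x \<in> {(a, b, g). a = - b \<and> Re g = 0}"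
    then obtain b g where "x = (- b, b, g)" "Re g = 0" by auto
    then have "xmat x = mat2 0 (cnj (Complex (2 * Im g) (2 * b))) (Complex (2 * Im g) (2 * b)) 0"
      by (simp add: xmat.simps mat2_eq_iff complex_eq_iff)
    then show "xmat x \<in> {mat2 0 (cnj c) c 0 | c. True}" by blast
  qed (auto simp: xmat.simps mat2_eq_iff complex_eq_iff)
  show "xmat ` {(a, b, g). b = 0 \<and> Re g = 0} = {mat2 (of_real y) (Complex x y) (Complex x (-y)) (of_real y) | x y. True}"
  proof (rule image_eq_inverseI[where g = "\<lambda>M. (Re (M$1$1), 0, \<i> * of_real (Re (M$1$2) / 2))"])
    fix x :: "real \<times> real \<times> complex" assume "x \<in> {(a, b, g). b = 0 \<and> Re g = 0}"
    then obtain a g where "x = (a, 0, g)" "Re g = 0" by auto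
    then have "xmat x = mat2 (of_real a) (Complex (2 * Im g) a) (Complex (2 * Im g) (- a)) (of_real a)"
      by (simp add: xmat.simps mat2_eq_iff complex_eq_iff)
    then show "xmat x \<in> {mat2 (of_real y) (Complex x y) (Complex x (-y)) (of_real y) | x y. True}" by blast
  qed (auto simp: xmat.simps mat2_eq_iff complex_eq_iff)
  have "trace (xmat (a, b, g)) = of_real (2 * Im (xmat (a, b, g) $ 1 $ 2)) \<longleftrightarrow> b = 0" for a b g
    by (auto simp: xmat.simps trace_def sum_2 complex_eq_iff)
  then show "xmat ` {(a, b, g). b = 0} = {X \<in> hermitian_mats. trace X = of_real (2 * Im (X $ 1 $ 2))}"
    unfolding range_xmat[symmetric] by auto
  show "xmat ` {(a, b, g). True} = hermitian_mats"
    using range_xmat by (simp add: case_prod_unfold)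
qed

lemma normal_forms_eq: "normal_forms = map (\<lambda>(W, V). (ymat ` W, xmat ` V)) coord_forms"
  unfolding normal_forms_def coord_forms_def list.map prod.case xmat_images ymat_images by (rule refl)

definition has_normal_form :: "(complex \<times> complex \<times> complex) set \<Rightarrow> (real \<times> real \<times> complex) set \<Rightarrow> bool" where
  "has_normal_form W V \<longleftrightarrow> (\<exists>p\<in>set coord_forms. equivalent_ops (coord_ops (fst p) (snd p)) (coord_ops W V))"

lemma has_normal_form_self: "(W, V) \<in> set coord_forms \<Longrightarrow> has_normal_form W V"
  unfolding has_normal_form_def using equivalent_ops_refl by (intro bexI[of _ "(W, V)"]) simp_all

lemma has_normal_form_equivalent:
  assumes "equivalent_ops (coord_ops W V) (coord_ops W' V')" "has_normal_form W' V'"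
  shows "has_normal_form W V"
proof -
  from assms(2) obtain p where "p \<in> set coord_forms" "equivalent_ops (coord_ops (fst p) (snd p)) (coord_ops W' V')"
    unfolding has_normal_form_def by blast
  then show ?thesis
    using equivalent_ops_trans[OF _ equivalent_ops_sym[OF assms(1)]] unfolding has_normal_form_def by blast
qed

lemmas has_normal_form_rot = has_normal_form_equivalent[OF equivalent_rot]
  and has_normal_form_swap = has_normal_form_equivalent[OF equivalent_swap]

lemma zero_triples: "{(a, b, g). a = 0 \<and> b = 0 \<and> g = 0} = {0 :: 'a::zero \<times> 'b::zero \<times> 'c::zero}"
  by (auto simp: zero_prod_def)

text \<open>With l^2 = i/c, the factor l / cnj l = l^2 / |l|^2 carries c to the positive imaginary
  axis. That axis is the target because (0, 0, g) is the matrix psi(2g) and the representative of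
  these lines is psi(i).\<close>

lemma normalizing_rotation:
  assumes "c \<noteq> 0"
  obtains l where "l \<noteq> 0" "l / cnj l * c = \<i> / of_real ((cmod l)\<^sup>2)"
proof
  define l where "l = csqrt (\<i> / c)"
  have l2: "l\<^sup>2 = \<i> / c" unfolding l_def by (rule power2_csqrt)
  then show l: "csqrt (\<i> / c) \<noteq> 0" using assms by (auto simp: l_def)
  have "l / cnj l = l\<^sup>2 / (l * cnj l)"
    using l by (simp add: l_def[symmetric] power2_eq_square)
  then show "csqrt (\<i> / c) / cnj (csqrt (\<i> / c)) * c = \<i> / of_real ((cmod (csqrt (\<i> / c)))\<^sup>2)"
    unfolding l_def[symmetric] complex_norm_square using l2 assms by simp
qed

text \<open>The first image serves W = C I, the second W = W_0. The Z0-coordinate is merely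
  multiplied by |l|^2, so the second set is normalised by the same rotation.\<close>

lemma rotated_lines:
  assumes "l \<noteq> 0" "l / cnj l * c = \<i> / of_real ((cmod l)\<^sup>2)"
  shows "rotx l ` range (\<lambda>t. (0, 0, of_real t * c)) = {(a, b, g). a = 0 \<and> b = 0 \<and> Re g = 0}"
    and "rotx l ` {(a, 0, of_real t * c) | a t. True} = {(a, b, g). b = 0 \<and> Re g = 0}"
proof -
  have img: "rotx l (a, 0, of_real t * c) = ((cmod l)\<^sup>2 * a, 0, \<i> * of_real (t / (cmod l)\<^sup>2))" for a t
  proof -
    have "l / cnj l * (of_real t * c) = of_real t * (l / cnj l * c)" by simp
    then show ?thesis unfolding assms(2) by simp
  qed
  have inv: "rotx l (a / (cmod l)\<^sup>2, 0, of_real ((cmod l)\<^sup>2 * Im g) * c) = (a, 0, g)" if "Re g = 0" for a g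
    unfolding img using assms(1) that by (simp add: complex_eq_iff)
  show "rotx l ` range (\<lambda>t. (0, 0, of_real t * c)) = {(a, b, g). a = 0 \<and> b = 0 \<and> Re g = 0}"
  proof (rule image_eq_inverseI[where g = "\<lambda>(a, b, g). (0, 0, of_real ((cmod l)\<^sup>2 * Im g) * c)"])
    fix x :: "real \<times> real \<times> complex" assume "x \<in> range (\<lambda>t. (0, 0, of_real t * c))"
    then obtain t where "x = (0, 0, of_real t * c)" by blast
    then show "rotx l x \<in> {(a, b, g). a = 0 \<and> b = 0 \<and> Re g = 0}" using img[of 0 t] by simp
  next
    fix x :: "real \<times> real \<times> complex" assume "x \<in> {(a, b, g). a = 0 \<and> b = 0 \<and> Re g = 0}"
    then obtain g where x: "x = (0, 0, g)" "Re g = 0" by auto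
    show "(case x of (a, b, g) \<Rightarrow> (0, 0, of_real ((cmod l)\<^sup>2 * Im g) * c)) \<in> range (\<lambda>t. (0, 0, of_real t * c))
      \<and> rotx l (case x of (a, b, g) \<Rightarrow> (0, 0, of_real ((cmod l)\<^sup>2 * Im g) * c)) = x"
      unfolding x(1) prod.case using inv[OF x(2), of 0, unfolded div_0] by blast
  qed
  show "rotx l ` {(a, 0, of_real t * c) | a t. True} = {(a, b, g). b = 0 \<and> Re g = 0}"
  proof (rule image_eq_inverseI[where g = "\<lambda>(a, b, g). (a / (cmod l)\<^sup>2, 0, of_real ((cmod l)\<^sup>2 * Im g) * c)"])
    fix x :: "real \<times> real \<times> complex" assume "x \<in> {(a, 0, of_real t * c) | a t. True}"
    then obtain a t where "x = (a, 0, of_real t * c)" by blast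
    then show "rotx l x \<in> {(a, b, g). b = 0 \<and> Re g = 0}" using img[of a t] by simp
  next
    fix x :: "real \<times> real \<times> complex" assume "x \<in> {(a, b, g). b = 0 \<and> Re g = 0}"
    then obtain a g where x: "x = (a, 0, g)" "Re g = 0" by auto
    show "(case x of (a, b, g) \<Rightarrow> (a / (cmod l)\<^sup>2, 0, of_real ((cmod l)\<^sup>2 * Im g) * c)) \<in> {(a, 0, of_real t * c) | a t. True}
      \<and> rotx l (case x of (a, b, g) \<Rightarrow> (a / (cmod l)\<^sup>2, 0, of_real ((cmod l)\<^sup>2 * Im g) * c)) = x"
      unfolding x(1) prod.case inv[OF x(2)] by blast
  qed
qed

lemma roty_invariant:
  assumes "l \<noteq> 0"
  shows "roty l ` {(y, u, w). u = 0 \<and> w = 0} = {(y, u, w). u = 0 \<and> w = 0}"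
    and "roty l ` {(y, u, w). w = 0} = {(y, u, w). w = 0}"
  by (rule image_eq_inverseI[where g = "roty (1 / l)"]; use assms in \<open>auto simp: power_divide\<close>)+

section \<open>Normalising V for each standard W\<close>

lemma normal_form_0:
  assumes "multialg {(y, u, w). y = 0 \<and> u = 0 \<and> w = 0} V"
  shows "has_normal_form {(y, u, w). y = 0 \<and> u = 0 \<and> w = 0} V"
  using multialg_0_cases[OF assms[unfolded zero_triples]]
proof (elim disjE)
  assume V: "V = {0}"
  show ?thesis unfolding V zero_triples[symmetric] by (rule has_normal_form_self) (simp add: coord_forms_def)
next
  assume "V = range (\<lambda>a. (a, 0, 0))"
  then have V: "V = {(a, b, g). b = 0 \<and> g = 0}" by auto
  show ?thesis unfolding V by (rule has_normal_form_self) (simp add: coord_forms_def)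
next
  \<comment> \<open>These are the real multiples of the conjugate of Z0, which the reflection takes
    to Z0.\<close>
  assume "V = range (\<lambda>b. (0, b, 0))"
  then have "swapx ` V = {(a, b, g). b = 0 \<and> g = 0}" by (force simp: image_iff)
  moreover have "swapy ` {(y, u, w). y = 0 \<and> u = 0 \<and> w = 0} = {(y, u, w). y = 0 \<and> u = 0 \<and> w = 0}"
    unfolding zero_triples by (simp add: zero_prod_def)
  ultimately have "has_normal_form (swapy ` {(y, u, w). y = 0 \<and> u = 0 \<and> w = 0}) (swapx ` V)"
    by (simp only:) (rule has_normal_form_self, simp add: coord_forms_def)
  then show ?thesis by (rule has_normal_form_swap)
qed

lemma line_eq:
  assumes "k \<noteq> (0::real)"
  shows "range (\<lambda>t. (t * k, 0, 0)) = {(a, b, g). b = 0 \<and> g = 0}"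
    and "range (\<lambda>t. (t * k, t * k, 0)) = {(a, b, g). a = b \<and> g = 0}"
    and "range (\<lambda>t. (t * k, t * - k, 0)) = {(a, b, g). a = - b \<and> g = 0}"
proof -
  have k: "\<exists>t. a = t * k" for a using assms by (intro exI[of _ "a / k"]) simp
  show "range (\<lambda>t. (t * k, 0, 0)) = {(a, b, g). b = 0 \<and> g = 0}"
    "range (\<lambda>t. (t * k, t * k, 0)) = {(a, b, g). a = b \<and> g = 0}"
    using k by (auto simp: image_iff)
  show "range (\<lambda>t. (t * k, t * - k, 0)) = {(a, b, g). a = - b \<and> g = 0}"
  proof
    show "{(a, b, g). a = - b \<and> g = 0} \<subseteq> range (\<lambda>t. (t * k, t * - k, 0))"
    proof clarify
      fix b
      have "(- b, b, 0) = (\<lambda>t. (t * k, t * - k, 0)) (- b / k)" using assms by simp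
      then show "(- b, b, 0) \<in> range (\<lambda>t. (t * k, t * - k, 0))" by blast
    qed
  qed auto
qed

lemma normal_form_I:
  assumes "multialg {(y, u, w). u = 0 \<and> w = 0} V"
  shows "has_normal_form {(y, u, w). u = 0 \<and> w = 0} V"
proof -
  let ?W = "{(y, u, w). u = 0 \<and> w = 0} :: (complex \<times> complex \<times> complex) set"
  have W: "?W = range (\<lambda>t. (t, 0, 0))" by auto
  have sW: "swapy ` ?W = ?W"
    by (rule image_eq_inverseI[where g = swapy]) auto
  have line0: "has_normal_form ?W (range (\<lambda>t. (t * k, 0, 0)))" if "k \<noteq> 0" for k
    unfolding line_eq(1)[OF that] by (rule has_normal_form_self) (simp add: coord_forms_def)
  from multialg_I_cases[OF assms[unfolded W]] show ?thesis
  proof (elim disjE exE conjE)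
    assume V: "V = {0}"
    show ?thesis unfolding V zero_triples[symmetric] by (rule has_normal_form_self) (simp add: coord_forms_def)
  next
    fix a b assume ab: "(a, b) \<noteq> (0, 0)" and V: "V = range (\<lambda>t. (t * a, t * b, 0))"
    consider "b = 0" "a \<noteq> 0" | "a = 0" "b \<noteq> 0" | "a \<noteq> 0" "b \<noteq> 0" using ab by auto
    then show ?thesis
    proof cases
      case 1
      then show ?thesis using line0[of a] by (simp add: V)
    next
      case 2
      have "swapx ` V = range (\<lambda>t. (t * b, 0, 0))" unfolding V image_image using 2 by simp
      then have "has_normal_form (swapy ` ?W) (swapx ` V)"
        unfolding sW using line0[of b] 2 by simp
      then show ?thesis by (rule has_normal_form_swap)
    next
      case 3
      \<comment> \<open>The rotation by l multiplies a by q = |l|^2 and divides b by q; this q makes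
        the two absolute values equal. The sign of ab cannot be changed in this way and decides
        between the lines of I and of i \<open>Rperp\<close>.\<close>
      define q where "q = sqrt \<bar>b / a\<bar>"
      define l where "l = complex_of_real (sqrt q)"
      have q: "q > 0" "q * q = \<bar>b / a\<bar>" using 3 by (simp_all add: q_def)
      have l: "l \<noteq> 0" "(cmod l)\<^sup>2 = q" using q by (simp_all add: l_def)
      have img: "rotx l ` V = range (\<lambda>t. (t * (q * a), t * (b / q), 0))"
        unfolding V image_image using l(2) by (simp add: algebra_simps)
      have k: "q * a \<noteq> 0" using q 3 by simp
      have "b = q * q * a \<or> b = - (q * q * a)"
        unfolding q(2) using 3 by (auto simp: abs_if)
      then have "b / q = q * a \<or> b / q = - (q * a)" using q(1) by (auto simp: field_simps)
      then have "has_normal_form (roty l ` ?W) (rotx l ` V)"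
      proof
        assume bq: "b / q = q * a"
        show ?thesis
          unfolding img bq line_eq(2)[OF k] roty_invariant(1)[OF l(1)]
          by (rule has_normal_form_self) (simp add: coord_forms_def)
      next
        assume bq: "b / q = - (q * a)"
        show ?thesis
          unfolding img bq line_eq(3)[OF k] roty_invariant(1)[OF l(1)]
          by (rule has_normal_form_self) (simp add: coord_forms_def)
      qed
      then show ?thesis by (rule has_normal_form_rot[OF l(1)])
    qed
  next
    assume "V = {(a, b, 0) | a b. True}"
    then have V: "V = {(a, b, g). g = 0}" by auto
    show ?thesis unfolding V by (rule has_normal_form_self) (simp add: coord_forms_def)
  next
    fix c assume c: "c \<noteq> 0" and V: "V = range (\<lambda>t. (0, 0, of_real t * c))"
    obtain l where l: "l \<noteq> 0" "l / cnj l * c = \<i> / of_real ((cmod l)\<^sup>2)"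
      using normalizing_rotation[OF c] .
    have "has_normal_form (roty l ` ?W) (rotx l ` V)"
      unfolding V rotated_lines(1)[OF l] roty_invariant(1)[OF l(1)]
      by (rule has_normal_form_self) (simp add: coord_forms_def)
    then show ?thesis by (rule has_normal_form_rot[OF l(1)])
  next
    assume "V = range (\<lambda>c. (0, 0, c))"
    then have V: "V = {(a, b, g). a = 0 \<and> b = 0}" by auto
    show ?thesis unfolding V by (rule has_normal_form_self) (simp add: coord_forms_def)
  qed
qed

lemma normal_form_e:
  assumes "multialg {(y, u, w). u = y \<and> w = y} V"
  shows "has_normal_form {(y, u, w). u = y \<and> w = y} V"
proof -
  have W: "{(y, u, w). u = y \<and> w = y} = range (\<lambda>t::complex. (t, t, t))" by auto
  from multialg_e_cases[OF assms[unfolded W]]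
  have "V = {(a, b, g). a = 0 \<and> b = 0 \<and> g = 0} \<or> V = {(a, b, g). a = b \<and> g = of_real b}"
    unfolding zero_triples by auto
  then show ?thesis
    by (elim disjE; hypsubst; intro has_normal_form_self; simp add: coord_forms_def)
qed

lemma normal_form_z:
  assumes "multialg {(y, u, w). y = 0 \<and> w = 0} V"
  shows "has_normal_form {(y, u, w). y = 0 \<and> w = 0} V"
proof -
  have W: "{(y, u, w). y = 0 \<and> w = 0} = range (\<lambda>t::complex. (0::complex, t, 0::complex))" by auto
  from multialg_z_cases[OF assms[unfolded W]]
  have "V = {(a, b, g). a = 0 \<and> b = 0 \<and> g = 0} \<or> V = {(a, b, g). b = 0 \<and> g = 0}"
    unfolding zero_triples by auto
  then show ?thesis
    by (elim disjE; hypsubst; intro has_normal_form_self; simp add: coord_forms_def)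
qed

lemma normal_form_D:
  assumes "multialg {(y, u, w). u = w} V"
  shows "has_normal_form {(y, u, w). u = w} V"
proof -
  let ?W = "{(y, u, w). u = w} :: (complex \<times> complex \<times> complex) set"
  have W: "?W = {(y, t, t) | y t. True}" by auto
  from multialg_D_cases[OF assms[unfolded W]] show ?thesis
  proof (elim disjE)
    assume V: "V = {0}"
    show ?thesis unfolding V zero_triples[symmetric] by (rule has_normal_form_self) (simp add: coord_forms_def)
  next
    assume "V = range (\<lambda>a. (a, a, of_real a))"
    then have V: "V = {(a, b, g). a = b \<and> g = of_real b}" by auto
    show ?thesis unfolding V by (rule has_normal_form_self) (simp add: coord_forms_def)
  next
    \<comment> \<open>This is the line of e2 e2^T. The rotation with l = i is the quarter turn
      \<open>Rperp\<close>, which exchanges it with the line of e1 e1^T and preserves the diagonal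
      matrices.\<close>
    assume V: "V = range (\<lambda>a. (a, a, - of_real a))"
    have "roty \<i> ` ?W = ?W"
      by (rule image_eq_inverseI[where g = "roty \<i>"]) auto
    moreover have "rotx \<i> ` V = {(a, b, g). a = b \<and> g = of_real b}"
      unfolding V image_image by auto
    ultimately have "has_normal_form (roty \<i> ` ?W) (rotx \<i> ` V)"
      by (simp only:) (rule has_normal_form_self, simp add: coord_forms_def)
    then show ?thesis by (rule has_normal_form_rot[rotated]) simp
  next
    assume "V = {(a, a, of_real r) | a r. True}"
    moreover have "{(a, a, of_real r) | a r. True} = {(a, b, g). a = b \<and> Im g = 0}"
      by (auto simp: complex_eq_iff intro: exI[of _ "Re _"])
    ultimately have V: "V = {(a, b, g). a = b \<and> Im g = 0}" by simp
    show ?thesis unfolding V by (rule has_normal_form_self) (simp add: coord_forms_def)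
  next
    assume "V = {(- x, x, \<i> * of_real y) | x y. True}"
    moreover have "{(- x, x, \<i> * of_real y) | x y. True} = {(a, b, g). a = - b \<and> Re g = 0}"
      by (auto simp: complex_eq_iff intro: exI[of _ "Im _"])
    ultimately have V: "V = {(a, b, g). a = - b \<and> Re g = 0}" by simp
    show ?thesis unfolding V by (rule has_normal_form_self) (simp add: coord_forms_def)
  qed
qed

lemma normal_form_N:
  assumes "multialg {(y, u, w). w = 0} V"
  shows "has_normal_form {(y, u, w). w = 0} V"
proof -
  let ?W = "{(y, u, w). w = 0} :: (complex \<times> complex \<times> complex) set"
  have W: "?W = {(y, u, 0) | y u. True}" by auto
  from multialg_N_cases[OF assms[unfolded W]] show ?thesis
  proof (elim disjE exE conjE)
    assume V: "V = {0}"
    show ?thesis unfolding V zero_triples[symmetric] by (rule has_normal_form_self) (simp add: coord_forms_def)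
  next
    assume "V = range (\<lambda>a. (a, 0, 0))"
    then have V: "V = {(a, b, g). b = 0 \<and> g = 0}" by auto
    show ?thesis unfolding V by (rule has_normal_form_self) (simp add: coord_forms_def)
  next
    fix c assume c: "c \<noteq> 0" and V: "V = {(a, 0, of_real t * c) | a t. True}"
    obtain l where l: "l \<noteq> 0" "l / cnj l * c = \<i> / of_real ((cmod l)\<^sup>2)"
      using normalizing_rotation[OF c] .
    have "has_normal_form (roty l ` ?W) (rotx l ` V)"
      unfolding V rotated_lines(2)[OF l] roty_invariant(2)[OF l(1)]
      by (rule has_normal_form_self) (simp add: coord_forms_def)
    then show ?thesis by (rule has_normal_form_rot[OF l(1)])
  next
    assume "V = {(a, 0, c) | a c. True}"
    then have V: "V = {(a, b, g). b = 0}" by auto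
    show ?thesis unfolding V by (rule has_normal_form_self) (simp add: coord_forms_def)
  qed
qed

lemma normal_form_UNIV:
  assumes "multialg {(y, u, w). True} V"
  shows "has_normal_form {(y, u, w). True} V"
proof -
  have W: "{(y, u, w). True} = (UNIV :: (complex \<times> complex \<times> complex) set)" by auto
  from multialg_UNIV_cases[OF assms[unfolded W]]
  have "V = {(a, b, g). a = 0 \<and> b = 0 \<and> g = 0} \<or> V = {(a, b, g). True}"
    unfolding zero_triples by auto
  then show ?thesis
    by (elim disjE; hypsubst; intro has_normal_form_self; simp add: coord_forms_def)
qed

lemma multialg_has_normal_form:
  assumes M: "multialg W V"
  shows "has_normal_form W V"
proof -
  have swap: "has_normal_form W V" if "swapy ` W = W'" "\<And>V. multialg W' V \<Longrightarrow> has_normal_form W' V" for W'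
    using has_normal_form_swap multialg_swap[OF M] that by blast
  have rot: "has_normal_form W V" if "l \<noteq> 0" "roty l ` W = W'" "\<And>V. multialg W' V \<Longrightarrow> has_normal_form W' V" for l W'
    using has_normal_form_rot[OF that(1)] multialg_rot[OF that(1) M] that(2,3) by blast
  \<comment> \<open>With l^2 = 1/u the rotation takes (u, w) to (1, uw) = (1, 1).\<close>
  have root: "csqrt (1 / u) \<noteq> 0" "(csqrt (1 / u))\<^sup>2 * (t * u) = t" "t * w / (csqrt (1 / u))\<^sup>2 = t"
    if "u * w = 1" for u w t
    using that by (auto simp: field_simps)
  from jordan_algebras_classification[OF M] show ?thesis
  proof (elim disjE exE conjE)
    assume "W = {(0, 0, 0)}"
    then have "W = {(y, u, w). y = 0 \<and> u = 0 \<and> w = 0}" by auto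
    then show ?thesis using normal_form_0 M by simp
  next
    assume "W = range (\<lambda>t. (t, 0, 0))"
    then have "W = {(y, u, w). u = 0 \<and> w = 0}" by auto
    then show ?thesis using normal_form_I M by simp
  next
    fix u w assume uw: "u * w = 1" and W: "W = range (\<lambda>t. (t, t * u, t * w))"
    have "roty (csqrt (1 / u)) ` W = range (\<lambda>t. (t, t, t))"
      unfolding W image_image roty.simps root(2,3)[OF uw] by (rule refl)
    also have "\<dots> = {(y, u, w). u = y \<and> w = y}" by auto
    finally show ?thesis using rot root(1)[OF uw] normal_form_e by blast
  next
    assume "W = range (\<lambda>t. (0, t, 0))"
    then have "W = {(y, u, w). y = 0 \<and> w = 0}" by auto
    then show ?thesis using normal_form_z M by simp
  next
    assume "W = range (\<lambda>t. (0, 0, t))"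
    then have "swapy ` W = {(y, u, w). y = 0 \<and> w = 0}" by (auto simp: image_image)
    then show ?thesis using swap normal_form_z by blast
  next
    fix u w assume uw: "u * w = 1" and W: "W = {(y, t * u, t * w) | y t. True}"
    have W': "W = (\<lambda>(y, t). (y, t * u, t * w)) ` UNIV" unfolding W by auto
    have "roty (csqrt (1 / u)) ` W = (\<lambda>(y, t). (y, t, t)) ` UNIV"
      unfolding W' image_image case_prod_unfold roty.simps root(2,3)[OF uw] by (rule refl)
    also have "\<dots> = {(y, u, w). u = w}" by auto
    finally show ?thesis using rot root(1)[OF uw] normal_form_D by blast
  next
    assume "W = {(y, u, 0) | y u. True}"
    then have "W = {(y, u, w). w = 0}" by auto
    then show ?thesis using normal_form_N M by simp
  next
    assume "W = {(y, 0, w) | y w. True}"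
    then have "swapy ` W = {(y, u, w). w = 0}" by (force simp: image_iff)
    then show ?thesis using swap normal_form_N by blast
  next
    assume "W = UNIV"
    then have "W = {(y, u, w). True}" by auto
    then show ?thesis using normal_form_UNIV M by simp
  qed
qed

text \<open>Neither component separates the list by itself, but no pair is repeated: V needs to be
  distinguished only among the entries that share a W.\<close>

lemma types_coord_forms:
  "map (\<lambda>(W, V). (wtype (ymat ` W), vtype (xmat ` V))) coord_forms =
   [(0, 0), (0, 6), (1, 0), (1, 2), (1, 5), (1, 3), (1, 6), (1, 1), (1, 4), (2, 0), (2, 6), (3, 0), (3, 6),
    (4, 0), (4, 6), (4, 1), (4, 3), (5, 0), (5, 6), (5, 5), (5, 4), (6, 0), (6, 1)]"
  unfolding coord_forms_def list.map prod.case wtype_values vtype_values vtype_1 vtype_2 vtype_3 vtype_4 vtype_5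
  by (rule refl)

theorem mainTheorem14:
  shows "length normal_forms = 23
    \<and> (\<forall>k<23. jordan_A0_multialgebra (ops_of (normal_forms ! k))
              \<and> SO2_invariant (ops_of (normal_forms ! k)))
    \<and> (\<forall>P. jordan_A0_multialgebra P \<and> SO2_invariant P
          \<longrightarrow> (\<exists>k<23. equivalent_ops (ops_of (normal_forms ! k)) P))
    \<and> (\<forall>j<23. \<forall>k<23. j \<noteq> k
          \<longrightarrow> \<not> equivalent_ops (ops_of (normal_forms ! j)) (ops_of (normal_forms ! k)))"
proof (intro conjI allI impI)
  define types where "types = map (\<lambda>(W, V). (wtype (ymat ` W), vtype (xmat ` V))) coord_forms"
  have nth: "normal_forms ! k = (ymat ` fst (coord_forms ! k), xmat ` snd (coord_forms ! k))"
    "multialg (fst (coord_forms ! k)) (snd (coord_forms ! k))"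
    "types ! k = (wtype (ymat ` fst (coord_forms ! k)), vtype (xmat ` snd (coord_forms ! k)))" if "k < 23" for k
    using that multialg_coord_forms length_coord_forms
    by (simp_all add: normal_forms_eq types_def case_prod_unfold list_all_length)
  show "length normal_forms = 23"
    by (simp add: normal_forms_eq length_coord_forms)
  show "jordan_A0_multialgebra (ops_of (normal_forms ! k))" "SO2_invariant (ops_of (normal_forms ! k))"
    if "k < 23" for k
    unfolding nth(1)[OF that] using nth(2)[OF that] by (simp_all add: coord_ops_jordan coord_ops_SO2)
  show "\<exists>k<23. equivalent_ops (ops_of (normal_forms ! k)) P"
    if P: "jordan_A0_multialgebra P \<and> SO2_invariant P" for P
  proof -
    obtain W V where WV: "multialg W V" "P = coord_ops W V"
      using SO2_invariant_eq_coord_ops P by blast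
    from multialg_has_normal_form[OF WV(1)] obtain p
      where p: "p \<in> set coord_forms" "equivalent_ops (coord_ops (fst p) (snd p)) P"
      unfolding has_normal_form_def WV(2) by blast
    then obtain k where "k < 23" "coord_forms ! k = p"
      unfolding in_set_conv_nth length_coord_forms by blast
    then show ?thesis
      using p(2) nth(1) by metis
  qed
  show "\<not> equivalent_ops (ops_of (normal_forms ! j)) (ops_of (normal_forms ! k))"
    if jk: "j < 23" "k < 23" "j \<noteq> k" for j k
  proof
    assume E: "equivalent_ops (ops_of (normal_forms ! j)) (ops_of (normal_forms ! k))"
    have 0: "0 \<in> ymat ` fst (coord_forms ! i)" "0 \<in> xmat ` snd (coord_forms ! i)" if "i < 23" for i
      using multialgD(2,5)[OF nth(2)[OF that]] xmat_0 ymat_0 by (metis imageI)+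
    have "types ! j = types ! k"
      using equivalent_types[OF E[unfolded nth(1)[OF jk(1)] nth(1)[OF jk(2)]]] 0 jk by (simp add: nth(3))
    moreover have "distinct types"
      unfolding types_def types_coord_forms by simp
    moreover have "length types = 23"
      by (simp add: types_def length_coord_forms)
    ultimately show False
      using jk nth_eq_iff_index_eq by metis
  qed
qed

end
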